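(* Let $B\in\mathrm{Bic}(T)$, let $B_1,\dots,B_k$ be all the biclosed sets covered by $B$, and write $\widetilde\lambda(B_i,B)=(s_i)_{\mathcal{D}_i}$, so $s_i=\lambda(B_i,B)$. Then $\psi(B)$ is the set of all labels of the form $(s_{i_1}\circ s_{i_2}\circ\cdots\circ s_{i_\ell})_{\mathcal{D}}$, where $s_{i_1}\circ\cdots\circ s_{i_\ell}$ (with each $s_{i_j}\in\{s_1,\dots,s_k\}$) is any element of $\overline{\{s_1,\dots,s_k\}}$ and $\mathcal{D}$ is any set of segments such that: (i) $|\mathcal{D}|$ equals the number of breaks of $s_{i_1}\circ\cdots\circ s_{i_\ell}$; (ii) each $t\in\mathcal{D}$ is a split of $s_{i_1}\circ\cdots\circ s_{i_\ell}$; (iii) no two distinct $t_1,t_2\in\mathcal{D}$ lie in the same break of $s_{i_1}\circ\cdots\circ s_{i_\ell}$; (iv) whenever $t\in\mathcal{D}$ is a non-faultline split of $s_{i_1}\circ\cdots\circ s_{i_\ell}$, either $t=s_{i_1}\circ\cdots\circ s_{i_{j-1}}\circ t_j$ for some $j\in\{1,\dots,\ell\}$ and some $t_j\in\mathcal{D}_{i_j}$ (meaning $t=t_1$ when $j=1$), or $t=t_j\circ s_{i_{j+1}}\circ\cdots\circ s_{i_\ell}$ for some $j\in\{1,\dots,\ell\}$ and some $t_j\in\mathcal{D}_{i_j}$ (meaning $t=t_\ell$ when $j=\ell$).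
   Context: Let $T$ be a finite tree embedded in a disk so that exactly its leaves lie on the boundary, with every non-leaf vertex of degree at least $3$; the embedding gives a cyclic order of edges at each vertex. A segment is an acyclic path $(v_1,\dots,v_n)$, $n\ge2$, of pairwise distinct consecutive-adjacent vertices such that for each $1\le j\le n-2$ the edge $\{v_{j+1},v_{j+2}\}$ is immediately clockwise or counterclockwise from $\{v_j,v_{j+1}\}$ at $v_{j+1}$; $\mathrm{Seg}(T)$ is the set of segments. For segments $s_1=(v_1,\dots,v_k)$, $s_2=(v_k,\dots,v_n)$ sharing only $v_k$, $s_1\circ s_2=(v_1,\dots,v_n)$; they are composable if this is a segment; iterated compositions denote concatenation in order. $B\subseteq\mathrm{Seg}(T)$ is closed if it contains $s_1\circ s_2$ for all composable $s_1,s_2\in B$, biclosed if $B$ and its complement are closed; $\overline{X}$ denotes the smallest closed set containing $X$. $\mathrm{Bic}(T)$ is the lattice of biclosed sets under inclusion; its covering relations are exactly pairs $(B',B'\sqcup\{s\})$ of biclosed sets, and $\lambda(B',B'\sqcup\{s\})=s$. A split of a segment $t$ is a proper subsegment of $t$ sharing an endpoint with $t$; a break of $[a,c]$ is a pair $\{[a,b],[b,c]\}$ with $b$ a vertex of $[a,c]$ strictly between $a$ and $c$. $\mathcal{S}_T$ is the set of labels $s_{\mathcal{D}}=(s,\mathcal{D})$ with $s$ having $m$ breaks and $\mathcal{D}$ a set of $m$ splits of $s$ no two in the same break; $\widetilde{\lambda}(B',B'\sqcup\{s\})=s_{\mathcal{D}}$ with $\mathcal{D}$ the set of splits of $s$ in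 $B'$. The shard intersection order element of $B$ is $\psi(B):=\{\widetilde\lambda(W,Z): \bigwedge_{i=1}^k B_i\le W\lessdot Z\le B\}$ (empty if $B=\emptyset$). Given a composition $s=s_{i_1}\circ\cdots\circ s_{i_\ell}$ with $s_{i_j}\in\{s_1,\dots,s_k\}$, a split of $s$ is a faultline split if it equals $s_{i_1}\circ\cdots\circ s_{i_j}$ for some $1\le j\le\ell-1$ or $s_{i_j}\circ\cdots\circ s_{i_\ell}$ for some $2\le j\le\ell$; otherwise it is a non-faultline split. *)

theory Defs
  imports Complex_Main "HOL-Combinatorics.Orbits"
begin

(* A tree embedded in a disk is recorded by its rotation system: cw T v u is the neighbour
   of v whose edge comes directly after the edge {v, u} in clockwise order around v. *)

record 'v plane_tree =
  verts :: "'v set"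
  edges :: "'v set set"
  cw :: "'v \<Rightarrow> 'v \<Rightarrow> 'v"

definition nbrs :: "'v plane_tree \<Rightarrow> 'v \<Rightarrow> 'v set" where
  "nbrs T v = {u. {v, u} \<in> edges T}"

definition walk :: "'v plane_tree \<Rightarrow> 'v list \<Rightarrow> bool" where
  "walk T p \<longleftrightarrow> p \<noteq> [] \<and> set p \<subseteq> verts T \<and>
     (\<forall>i. Suc i < length p \<longrightarrow> {p ! i, p ! Suc i} \<in> edges T)"

definition is_tree :: "'v plane_tree \<Rightarrow> bool" where
  "is_tree T \<longleftrightarrow> finite (verts T) \<and> verts T \<noteq> {} \<and>
     (\<forall>e\<in>edges T. \<exists>u\<in>verts T. \<exists>v\<in>verts T. u \<noteq> v \<and> e = {u, v}) \<and>
     (\<forall>u\<in>verts T. \<forall>v\<in>verts T. \<exists>p. walk T p \<and> hd p = u \<and> last p = v) \<and>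
     \<not> (\<exists>p. walk T p \<and> distinct p \<and> 3 \<le> length p \<and> {last p, hd p} \<in> edges T)"

(* The leaves are the vertices of degree 1; all other vertices have degree at least 3.
   Any rotation system on a tree comes from an embedding in a disk in which exactly the leaves
   lie on the boundary, so the boundary itself imposes no further condition. *)

definition is_plane_tree :: "'v plane_tree \<Rightarrow> bool" where
  "is_plane_tree T \<longleftrightarrow> is_tree T \<and>
     (\<forall>v\<in>verts T. cyclic_on (cw T v) (nbrs T v)) \<and>
     (\<forall>v\<in>verts T. card (nbrs T v) = 1 \<or> 3 \<le> card (nbrs T v))"

definition segment_path :: "'v plane_tree \<Rightarrow> 'v list \<Rightarrow> bool" where
  "segment_path T p \<longleftrightarrow> walk T p \<and> distinct p \<and> 2 \<le> length p \<and>
     (\<forall>j. Suc (Suc j) < length p \<longrightarrow>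
        p ! Suc (Suc j) = cw T (p ! Suc j) (p ! j) \<or> p ! j = cw T (p ! Suc j) (p ! Suc (Suc j)))"

(* A segment has no preferred direction: (v1, ..., vn) and (vn, ..., v1) are the same segment.
   It is represented by its set of vertices, which in a tree determines the path up to reversal. *)

definition Seg :: "'v plane_tree \<Rightarrow> 'v set set" where
  "Seg T = {set p | p. segment_path T p}"

definition endpoints :: "'v plane_tree \<Rightarrow> 'v set \<Rightarrow> 'v set" where
  "endpoints T s = (\<Union>p\<in>{p. segment_path T p \<and> set p = s}. {hd p, last p})"

(* composes T [s1, ..., sl] s says that s1 o ... o sl is defined and equal to s.  The paths ps
   orient the segments so that each one starts where its predecessor ends; this keeps the
   concatenation in the order of the list although segments are undirected.  Since the joined
   path is distinct, consecutive segments share exactly the vertex at which they are joined. *)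

definition composes :: "'v plane_tree \<Rightarrow> 'v set list \<Rightarrow> 'v set \<Rightarrow> bool" where
  "composes T ss s \<longleftrightarrow> ss \<noteq> [] \<and>
     (\<exists>ps. list_all2 (\<lambda>p r. segment_path T p \<and> set p = r) ps ss \<and>
        (\<forall>i. Suc i < length ps \<longrightarrow> last (ps ! i) = hd (ps ! Suc i)) \<and>
        segment_path T (hd ps @ concat (map tl (tl ps))) \<and>
        s = set (hd ps @ concat (map tl (tl ps))))"

definition seg_closed :: "'v plane_tree \<Rightarrow> 'v set set \<Rightarrow> bool" where
  "seg_closed T B \<longleftrightarrow> B \<subseteq> Seg T \<and> (\<forall>s1\<in>B. \<forall>s2\<in>B. \<forall>s. composes T [s1, s2] s \<longrightarrow> s \<in> B)"

definition seg_closure :: "'v plane_tree \<Rightarrow> 'v set set \<Rightarrow> 'v set set" where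
  "seg_closure T X = seg_closed T hull X"

definition Bic :: "'v plane_tree \<Rightarrow> 'v set set set" where
  "Bic T = {B. seg_closed T B \<and> seg_closed T (Seg T - B)}"

definition bic_covers :: "'v plane_tree \<Rightarrow> 'v set set \<Rightarrow> 'v set set \<Rightarrow> bool" where
  "bic_covers T W Z \<longleftrightarrow> W \<in> Bic T \<and> Z \<in> Bic T \<and> W \<subset> Z \<and> \<not> (\<exists>X\<in>Bic T. W \<subset> X \<and> X \<subset> Z)"

(* The greatest lower bound in the poset Bic T, which in general is not the intersection. *)

definition bic_Meet :: "'v plane_tree \<Rightarrow> 'v set set set \<Rightarrow> 'v set set" where
  "bic_Meet T \<B> = (GREATEST M. M \<in> Bic T \<and> (\<forall>B\<in>\<B>. M \<subseteq> B))"

definition is_split :: "'v plane_tree \<Rightarrow> 'v set \<Rightarrow> 'v set \<Rightarrow> bool" where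
  "is_split T u t \<longleftrightarrow> u \<in> Seg T \<and> t \<in> Seg T \<and> u \<subset> t \<and> endpoints T u \<inter> endpoints T t \<noteq> {}"

definition breaks :: "'v plane_tree \<Rightarrow> 'v set \<Rightarrow> 'v set set set" where
  "breaks T t = {{set (xs @ [b]), set (b # ys)} | xs b ys.
     xs \<noteq> [] \<and> ys \<noteq> [] \<and> segment_path T (xs @ b # ys) \<and> set (xs @ b # ys) = t}"

definition label :: "'v set set \<Rightarrow> 'v set set \<Rightarrow> 'v set" where
  "label W Z = the_elem (Z - W)"

definition refined_label :: "'v plane_tree \<Rightarrow> 'v set set \<Rightarrow> 'v set set \<Rightarrow> 'v set \<times> 'v set set" where
  "refined_label T W Z = (label W Z, {u \<in> W. is_split T u (label W Z)})"

(* For B = {} the result is empty, because no biclosed set is covered by {}. *)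

definition shard_psi :: "'v plane_tree \<Rightarrow> 'v set set \<Rightarrow> ('v set \<times> 'v set set) set" where
  "shard_psi T B = {refined_label T W Z | W Z.
     bic_Meet T {B'. bic_covers T B' B} \<subseteq> W \<and> bic_covers T W Z \<and> Z \<subseteq> B}"

(* faultline T ss u: the split u of the composition of ss = [s1, ..., sl] equals s1 o ... o sj
   with 1 <= j <= l - 1, or sj o ... o sl with 2 <= j <= l. *)

definition faultline :: "'v plane_tree \<Rightarrow> 'v set list \<Rightarrow> 'v set \<Rightarrow> bool" where
  "faultline T ss u \<longleftrightarrow>
     (\<exists>j\<in>{1..length ss - 1}. composes T (take j ss) u) \<or>
     (\<exists>j\<in>{2..length ss}. composes T (drop (j - 1) ss) u)"

end

theory Submission
  imports Defs
begin

text \<open>Write \<open>C\<close> for the complement of \<open>B\<close> and \<open>K\<close> for the closure of \<open>S = {s\<^sub>1, \<dots>, s\<^sub>k}\<close>.  Composing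
  an element of \<open>C\<close> with an element of \<open>K\<close> gives an element of \<open>C\<close>, and every break of an
  element of \<open>K\<close> has both parts in \<open>K\<close> (a faultline) or exactly one part in \<open>C\<close>.  Hence the
  meet of the \<open>B\<^sub>i\<close> is \<open>B - K\<close>, and \<open>Y \<mapsto> (B - K) \<union> Y\<close> identifies the subsets of \<open>K\<close> that are
  biclosed relative to \<open>K\<close> with the interval from this meet to \<open>B\<close>.  In a label of that
  interval the sides of the non-faultline breaks are therefore forced by \<open>C\<close>, while every choice
  of sides at the faultlines is realized by an explicit set \<open>Y\<close>.\<close>

section \<open>Paths in a tree\<close>

text \<open>Both facts about \<open>C\<close> come from the lower covers: the complement of each
  \<open>B_i\<close> is \<open>C\<close> with \<open>s_i\<close> added. Closedness of this set puts
  every composition of \<open>s_i\<close> with an element of \<open>C\<close> into \<open>C\<close>;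
  coclosedness puts a part of every break of \<open>s_i\<close> into \<open>C\<close>. Associativity
  carries the first fact to \<open>K\<close>, and comparing two breaks of one segment carries the
  second. For a set \<open>E\<close> with one split from each break, condition (iv) amounts to
  \<open>E\<close> avoiding \<open>C\<close>: splits assembled from pieces in \<open>B\<close> stay
  in \<open>B\<close>, and conversely a non-faultline split outside \<open>C\<close> cuts some
  factor in a part that is also outside \<open>C\<close>. So a label is an element of
  \<open>K\<close> with a choice of one side of each of its breaks, never a side in
  \<open>C\<close>. Segments are undirected vertex sets, so arguments about cuts first have to fix
  an orientation, which acyclicity makes unique up to reversal.\<close>

lemma segment_path_iff:
  "segment_path T p \<longleftrightarrow> 2 \<le> length p \<and> distinct p \<and> set p \<subseteq> verts T \<and>
     (\<forall>xs a b ys. p = xs @ a # b # ys \<longrightarrow> {a, b} \<in> edges T) \<and>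
     (\<forall>xs a b c ys. p = xs @ a # b # c # ys \<longrightarrow> c = cw T b a \<or> a = cw T b c)"
proof -
  have "(\<forall>i. Suc i < length p \<longrightarrow> {p ! i, p ! Suc i} \<in> edges T) \<longleftrightarrow>
      (\<forall>xs a b ys. p = xs @ a # b # ys \<longrightarrow> {a, b} \<in> edges T)" (is "?L \<longleftrightarrow> ?R")
  proof
    assume L: ?L
    show ?R
    proof (intro allI impI)
      fix xs a b ys assume "p = xs @ a # b # ys"
      then show "{a, b} \<in> edges T"
        using L[rule_format, of "length xs"] by (simp add: nth_append)
    qed
  next
    assume R: ?R
    show ?L
    proof (intro allI impI)
      fix i assume i: "Suc i < length p"
      have "p = take i p @ p ! i # p ! Suc i # drop (Suc (Suc i)) p"
        using i by (simp add: Cons_nth_drop_Suc)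
      then show "{p ! i, p ! Suc i} \<in> edges T" using R by blast
    qed
  qed
  moreover have "(\<forall>j. Suc (Suc j) < length p \<longrightarrow>
        p ! Suc (Suc j) = cw T (p ! Suc j) (p ! j) \<or> p ! j = cw T (p ! Suc j) (p ! Suc (Suc j))) \<longleftrightarrow>
      (\<forall>xs a b c ys. p = xs @ a # b # c # ys \<longrightarrow> c = cw T b a \<or> a = cw T b c)" (is "?L \<longleftrightarrow> ?R")
  proof
    assume L: ?L
    show ?R
    proof (intro allI impI)
      fix xs a b c ys assume "p = xs @ a # b # c # ys"
      then show "c = cw T b a \<or> a = cw T b c"
        using L[rule_format, of "length xs"] by (simp add: nth_append)
    qed
  next
    assume R: ?R
    show ?L
    proof (intro allI impI)
      fix i assume i: "Suc (Suc i) < length p"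
      have "p = take i p @ p ! i # p ! Suc i # p ! Suc (Suc i) # drop (Suc (Suc (Suc i))) p"
        using i by (simp add: Cons_nth_drop_Suc)
      then show "p ! Suc (Suc i) = cw T (p ! Suc i) (p ! i) \<or> p ! i = cw T (p ! Suc i) (p ! Suc (Suc i))"
        using R by blast
    qed
  qed
  ultimately show ?thesis
    unfolding segment_path_def walk_def by auto
qed

text \<open>In the infix form of \<open>segment_path_iff\<close>, two or three consecutive vertices
  of an infix are consecutive vertices of the whole list, so no index arithmetic arises.\<close>

lemma segment_path_sub:
  assumes "segment_path T (xs @ q @ ys)" "2 \<le> length q"
  shows "segment_path T q"
  unfolding segment_path_iff
proof (intro conjI allI impI)
  note p = assms(1)[unfolded segment_path_iff]
  show "2 \<le> length q" "distinct q" "set q \<subseteq> verts T" using p assms(2) by auto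
  fix us a b vs assume "q = us @ a # b # vs"
  then have "xs @ q @ ys = (xs @ us) @ a # b # (vs @ ys)" by simp
  then show "{a, b} \<in> edges T" using p by blast
next
  note p = assms(1)[unfolded segment_path_iff]
  fix us a b c vs assume "q = us @ a # b # c # vs"
  then have "xs @ q @ ys = (xs @ us) @ a # b # c # (vs @ ys)" by simp
  then show "c = cw T b a \<or> a = cw T b c" using p by blast
qed

lemma segment_path_rev:
  assumes "segment_path T p"
  shows "segment_path T (rev p)"
  unfolding segment_path_iff
proof (intro conjI allI impI)
  note p = assms[unfolded segment_path_iff]
  show "2 \<le> length (rev p)" "distinct (rev p)" "set (rev p) \<subseteq> verts T" using p by auto
  fix us a b vs assume "rev p = us @ a # b # vs"
  then have "p = rev vs @ b # a # rev us" by (simp add: rev_swap)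
  then have "{b, a} \<in> edges T" using p by blast
  then show "{a, b} \<in> edges T" by (simp add: insert_commute)
next
  note p = assms[unfolded segment_path_iff]
  fix us a b c vs assume "rev p = us @ a # b # c # vs"
  then have "p = rev vs @ c # b # a # rev us" by (simp add: rev_swap)
  then show "c = cw T b a \<or> a = cw T b c" using p by blast
qed

lemma segment_path_prefix:
  "segment_path T (xs @ b # ys) \<Longrightarrow> xs \<noteq> [] \<Longrightarrow> segment_path T (xs @ [b])"
  using segment_path_sub[of T "[]" "xs @ [b]" ys] by (cases xs) auto

lemma segment_path_suffix:
  "segment_path T (xs @ b # ys) \<Longrightarrow> ys \<noteq> [] \<Longrightarrow> segment_path T (b # ys)"
  using segment_path_sub[of T xs "b # ys" "[]"] by (cases ys) auto

lemma segment_path_distinct: "segment_path T p \<Longrightarrow> distinct p"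
  by (simp add: segment_path_def)

lemma segment_path_length: "segment_path T p \<Longrightarrow> 2 \<le> length p"
  by (simp add: segment_path_def)

lemma segment_path_Seg: "segment_path T p \<Longrightarrow> set p \<in> Seg T"
  by (auto simp: Seg_def)

lemma append_Cons_eq_append_ConsE:
  assumes "xs @ b # ys = us @ c # vs"
  obtains "xs = us" "b = c" "ys = vs"
    | zs where "xs = us @ c # zs" "vs = zs @ b # ys"
    | zs where "us = xs @ b # zs" "ys = zs @ c # vs"
  using assms by (auto simp: append_eq_append_conv2 append_eq_Cons_conv Cons_eq_append_conv)

text \<open>In a distinct list the first element of an infix fixes its position. Hence the place of
  a subsegment on an oriented path can be read off its vertex set.\<close>

lemma infix_unique:
  assumes "distinct (xs @ q @ ys)" "xs @ q @ ys = us @ r @ vs" "set q = set r" "q \<noteq> []"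
  shows "xs = us" "q = r" "ys = vs"
proof -
  \<comment> \<open>Stated for fresh lists, since it is applied a second time with the two
    decompositions exchanged. If the second infix started later, the head of the offset would lie in
    the first infix only.\<close>
  have aux: "zs = []"
    if "us = xs @ zs" "q @ ys = zs @ r @ vs" "distinct (xs @ q @ ys)" "set q = set r" "q \<noteq> []"
    for xs us zs q r ys vs :: "'a list"
  proof (rule ccontr)
    assume "zs \<noteq> []"
    with that(2,5) have "hd zs \<in> set q" by (metis hd_append2 hd_in_set)
    moreover have "hd zs \<notin> set r" using that(2,3) \<open>zs \<noteq> []\<close> by (cases zs) auto
    ultimately show False using that(4) by simp
  qed
  have r: "r \<noteq> []" using assms(3,4) by auto
  from assms(2) obtain zs where "us = xs @ zs \<and> q @ ys = zs @ r @ vs \<or> xs = us @ zs \<and> r @ vs = zs @ q @ ys"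
    using append_eq_append_conv2[of xs "q @ ys" us "r @ vs"] by metis
  then show xs: "xs = us"
  proof
    assume z: "us = xs @ zs \<and> q @ ys = zs @ r @ vs"
    have "zs = []" using aux[OF conjunct1[OF z] conjunct2[OF z] assms(1,3,4)] .
    then show ?thesis using z by simp
  next
    assume z: "xs = us @ zs \<and> r @ vs = zs @ q @ ys"
    have "distinct (us @ r @ vs)" using assms(1,2) by metis
    from aux[OF conjunct1[OF z] conjunct2[OF z] this assms(3)[symmetric] r]
    show ?thesis using z by simp
  qed
  have "length q = length r"
    
    using assms(1,3) arg_cong[OF assms(2), of distinct] distinct_card[of q] distinct_card[of r] by simp
  then show "q = r" "ys = vs" using xs assms(2) by auto
qed

text \<open>An edge between vertices that are not consecutive on the path would close the stretch
  between them to a cycle of length at least 3.\<close>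

lemma tree_path_induced:
  assumes T: "is_tree T" and p: "segment_path T (xs @ a # ms @ b # ys)" and e: "{a, b} \<in> edges T"
  shows "ms = []"
proof (rule ccontr)
  assume ms: "ms \<noteq> []"
  then have "2 \<le> length (a # ms @ [b])" by simp
  moreover have "xs @ a # ms @ b # ys = xs @ (a # ms @ [b]) @ ys" by simp
  ultimately have q: "segment_path T (a # ms @ [b])" using p segment_path_sub by metis
  have "3 \<le> length (a # ms @ [b])" using ms by (cases ms) auto
  moreover have "{last (a # ms @ [b]), hd (a # ms @ [b])} \<in> edges T"
    using e by (simp add: insert_commute)
  ultimately show False
    using T q unfolding is_tree_def segment_path_def by blast
qed

text \<open>By acyclicity, adjacent vertices of a path \<open>q\<close> inside the vertex set of \<open>p\<close> are adjacent
  along \<open>p\<close>, so \<open>q\<close> runs monotonically through \<open>p\<close>.\<close>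

lemma tree_subpath_aux:
  assumes T: "is_tree T" and p: "segment_path T p"
  shows "q \<noteq> [] \<Longrightarrow> distinct q \<Longrightarrow> set q \<subseteq> set p \<Longrightarrow>
    \<forall>xs a b ys. q = xs @ a # b # ys \<longrightarrow> {a, b} \<in> edges T \<Longrightarrow>
    \<exists>xs ys. p = xs @ q @ ys \<or> p = xs @ rev q @ ys"
proof (induction q rule: induct_list012)
  case 1
  then show ?case by simp
next
  case (2 a)
  then show ?case using split_list[of a p] by auto
next
  case (3 a b q)
  have ab: "{a, b} \<in> edges T" using "3.prems"(4)[rule_format, of "[]" a b q] by simp
  have ba: "{b, a} \<in> edges T" using ab by (simp add: insert_commute)
  have "\<forall>xs c d ys. b # q = xs @ c # d # ys \<longrightarrow> {c, d} \<in> edges T"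
    using "3.prems"(4) by (metis append_Cons)
  then obtain xs ys where h: "p = xs @ (b # q) @ ys \<or> p = xs @ rev (b # q) @ ys"
    using 3 by auto
  have a: "a \<in> set p" "a \<noteq> b" "a \<notin> set q" using "3.prems" by auto
  from h show ?case
  proof
    assume h: "p = xs @ (b # q) @ ys"
    then have "a \<in> set xs \<or> a \<in> set ys" using a by auto
    then show ?thesis
    proof
      assume "a \<in> set xs"
      then obtain us vs where x: "xs = us @ a # vs" by (meson split_list)
      then have "vs = []" using tree_path_induced[OF T _ ab, of us vs "q @ ys"] p h by simp
      then show ?thesis using h x by auto
    next
      assume "a \<in> set ys"
      then obtain us vs where y: "ys = us @ a # vs" by (meson split_list)
      \<comment> \<open>\<open>a\<close> can stand on the far side of \<open>q\<close> only if
        \<open>q\<close> is empty; then the pair \<open>a\<close>, \<open>b\<close> occurs reversed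
        in \<open>p\<close>.\<close>
      then have "q @ us = []" using tree_path_induced[OF T _ ba, of xs "q @ us" vs] p h by simp
      then have "p = xs @ rev (a # b # q) @ vs" using h y by auto
      then show ?thesis by blast
    qed
  next
    assume h: "p = xs @ rev (b # q) @ ys"
    then have "a \<in> set xs \<or> a \<in> set ys" using a by auto
    then show ?thesis
    proof
      assume "a \<in> set xs"
      then obtain us vs where x: "xs = us @ a # vs" by (meson split_list)
      then have "vs @ rev q = []" using tree_path_induced[OF T _ ab, of us "vs @ rev q" ys] p h by simp
      then have "p = us @ (a # b # q) @ ys" using h x by auto
      then show ?thesis by blast
    next
      assume "a \<in> set ys"
      then obtain us vs where y: "ys = us @ a # vs" by (meson split_list)
      then have "us = []" using tree_path_induced[OF T _ ba, of "xs @ rev q" us vs] p h by simp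
      then have "p = xs @ rev (a # b # q) @ vs" using h y by auto
      then show ?thesis by blast
    qed
  qed
qed

lemma tree_subpath:
  assumes "is_tree T" "segment_path T p" "segment_path T q" "set q \<subseteq> set p"
  shows "\<exists>xs ys. p = xs @ q @ ys \<or> p = xs @ rev q @ ys"
proof -
  note q = assms(3)[unfolded segment_path_iff]
  then have "q \<noteq> []" by auto
  then show ?thesis using tree_subpath_aux[OF assms(1,2), of q] q assms(4) by blast
qed

lemma tree_path_unique:
  assumes "is_tree T" "segment_path T p" "segment_path T q" "set p = set q"
  shows "q = p \<or> q = rev p"
proof -
  obtain xs ys where h: "p = xs @ q @ ys \<or> p = xs @ rev q @ ys"
    using tree_subpath[OF assms(1-3)] assms(4) by blast
  have "length p = length q"
    using assms segment_path_distinct distinct_card by metis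
  with h have "xs = [] \<and> ys = []" by auto
  with h show ?thesis by auto
qed

lemma tree_endpoints:
  assumes "is_tree T" "segment_path T p"
  shows "endpoints T (set p) = {hd p, last p}"
proof -
  have ne: "p \<noteq> []" using segment_path_length[OF assms(2)] by auto
  have "q = p \<or> q = rev p" if "segment_path T q" "set q = set p" for q
    using tree_path_unique[OF assms that(1)] that(2) by auto
  then show ?thesis
    using assms(2) ne unfolding endpoints_def by (fastforce simp: hd_rev last_rev)
qed

section \<open>Binary composition\<close>

text \<open>One inner vertex \<open>b\<close> of one path describes a composable pair with its
  composition and also a break of a segment. So closedness, coclosedness, breaks and (in a tree)
  splits are all expressed by this single relation.\<close>

definition glue :: "'v plane_tree \<Rightarrow> 'v set \<Rightarrow> 'v set \<Rightarrow> 'v set \<Rightarrow> bool" where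
  "glue T u v w \<longleftrightarrow> (\<exists>xs b ys. xs \<noteq> [] \<and> ys \<noteq> [] \<and> segment_path T (xs @ b # ys) \<and>
     u = set (xs @ [b]) \<and> v = set (b # ys) \<and> w = set (xs @ b # ys))"

lemma glueI:
  "segment_path T (xs @ b # ys) \<Longrightarrow> xs \<noteq> [] \<Longrightarrow> ys \<noteq> [] \<Longrightarrow>
    u = set (xs @ [b]) \<Longrightarrow> v = set (b # ys) \<Longrightarrow> w = set (xs @ b # ys) \<Longrightarrow> glue T u v w"
  unfolding glue_def by blast

lemma composes_pair: "composes T [u, v] w \<longleftrightarrow> glue T u v w"
proof
  assume "composes T [u, v] w"
  then obtain p q where
    *: "segment_path T p" "set p = u" "segment_path T q" "set q = v" "last p = hd q"
      "segment_path T (p @ tl q)" "w = set (p @ tl q)"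
    unfolding composes_def by (auto simp: list_all2_Cons2)
  from *(1) obtain xs b where p: "p = xs @ [b]" "xs \<noteq> []"
    by (metis append_Nil append_butlast_last_id segment_path_length list.size(3) length_Cons
        not_numeral_le_zero numeral_2_eq_2 Suc_n_not_le_n One_nat_def)
  from *(3,5) p obtain ys where q: "q = b # ys" "ys \<noteq> []"
    using segment_path_length[OF *(3)] by (cases q) (auto simp: Suc_le_length_iff numeral_2_eq_2)
  show "glue T u v w" by (rule glueI[of T xs b ys]) (use * p q in auto)
next
  assume "glue T u v w"
  then obtain xs b ys where
    *: "xs \<noteq> []" "ys \<noteq> []" "segment_path T (xs @ b # ys)" "u = set (xs @ [b])"
       "v = set (b # ys)" "w = set (xs @ b # ys)"
    unfolding glue_def by blast
  have "segment_path T (xs @ [b])" "segment_path T (b # ys)"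
    using * segment_path_prefix segment_path_suffix by metis+
  then show "composes T [u, v] w"
    unfolding composes_def using *
    by (intro conjI exI[of _ "[xs @ [b], b # ys]"]) auto
qed

lemma glue_commute:
  assumes "glue T u v w"
  shows "glue T v u w"
proof -
  obtain xs b ys where
    *: "xs \<noteq> []" "ys \<noteq> []" "segment_path T (xs @ b # ys)" "u = set (xs @ [b])"
       "v = set (b # ys)" "w = set (xs @ b # ys)"
    using assms unfolding glue_def by blast
  show ?thesis
    by (rule glueI[of T "rev ys" b "rev xs"]) (use * segment_path_rev[OF *(3)] in auto)
qed

lemma glue_Seg:
  assumes "glue T u v w"
  shows "u \<in> Seg T" "v \<in> Seg T" "w \<in> Seg T"
  using assms segment_path_prefix segment_path_suffix segment_path_Seg
  unfolding glue_def by metis+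

lemma glue_subset:
  assumes "glue T u v w"
  shows "u \<subset> w" "v \<subset> w" "\<not> u \<subseteq> v" "\<not> v \<subseteq> u"
proof -
  obtain xs b ys where
    *: "xs \<noteq> []" "ys \<noteq> []" "segment_path T (xs @ b # ys)" "u = set (xs @ [b])"
       "v = set (b # ys)" "w = set (xs @ b # ys)"
    using assms unfolding glue_def by blast
  have d: "distinct (xs @ b # ys)" using * segment_path_distinct by blast
  obtain x xs' y ys' where "xs = x # xs'" "ys = ys' @ [y]"
    using *(1,2) by (meson list.exhaust rev_exhaust)
  then have "x \<in> u" "x \<notin> v" "y \<in> v" "y \<notin> u"
    using * d by auto
  then show "u \<subset> w" "v \<subset> w" "\<not> u \<subseteq> v" "\<not> v \<subseteq> u" using * by auto
qed

lemma breaks_eq: "breaks T t = {{u, v} | u v. glue T u v t}"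
  unfolding breaks_def glue_def by blast

lemma seg_closed_iff:
  "seg_closed T B \<longleftrightarrow> B \<subseteq> Seg T \<and> (\<forall>u v w. u \<in> B \<longrightarrow> v \<in> B \<longrightarrow> glue T u v w \<longrightarrow> w \<in> B)"
  unfolding seg_closed_def composes_pair by blast

section \<open>Iterated composition\<close>

fun join_paths :: "'a list list \<Rightarrow> 'a list" where
  "join_paths [] = []"
| "join_paths (p # ps) = p @ concat (map tl ps)"

lemma join_paths_append:
  assumes "ps \<noteq> []" "qs \<noteq> []" "hd qs \<noteq> []"
  shows "join_paths (ps @ qs) = join_paths ps @ tl (join_paths qs)"
  using assms by (cases ps; cases qs) auto

lemma join_paths_Cons:
  "qs \<noteq> [] \<Longrightarrow> hd qs \<noteq> [] \<Longrightarrow> join_paths (p # qs) = p @ tl (join_paths qs)"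
  using join_paths_append[of "[p]" qs] by simp

text \<open>That the joined list is a segment path is deliberately left out: this makes
  \<open>path_chain_append\<close> an equivalence, and \<open>composes_iff\<close> adds the
  condition back.\<close>

definition path_chain :: "'v plane_tree \<Rightarrow> 'v list list \<Rightarrow> bool" where
  "path_chain T ps \<longleftrightarrow> ps \<noteq> [] \<and> (\<forall>p\<in>set ps. segment_path T p) \<and>
     successively (\<lambda>p q. last p = hd q) ps"

lemma path_chain_single: "path_chain T [p] \<longleftrightarrow> segment_path T p"
  by (simp add: path_chain_def)

lemma path_chain_append:
  assumes "ps \<noteq> []" "qs \<noteq> []"
  shows "path_chain T (ps @ qs) \<longleftrightarrow>
    path_chain T ps \<and> path_chain T qs \<and> last (last ps) = hd (hd qs)"
  using assms by (auto simp: path_chain_def successively_append_iff)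

lemma path_chain_Cons:
  "qs \<noteq> [] \<Longrightarrow> path_chain T (p # qs) \<longleftrightarrow> segment_path T p \<and> path_chain T qs \<and> last p = hd (hd qs)"
  using path_chain_append[of "[p]" qs T] by (simp add: path_chain_single)

lemma path_chain_hd:
  assumes "path_chain T ps"
  shows "hd ps \<noteq> []" "join_paths ps \<noteq> []" "hd (join_paths ps) = hd (hd ps)"
proof -
  obtain p qs where ps: "ps = p # qs" using assms by (cases ps) (auto simp: path_chain_def)
  then have "segment_path T p" using assms by (simp add: path_chain_def)
  then have "p \<noteq> []" using segment_path_length[of T p] by auto
  then show "hd ps \<noteq> []" "join_paths ps \<noteq> []" "hd (join_paths ps) = hd (hd ps)"
    using ps by auto
qed

lemma path_chain_last:
  "path_chain T ps \<Longrightarrow> 2 \<le> length (join_paths ps) \<and> last (join_paths ps) = last (last ps)"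
proof (induction ps rule: induct_list012)
  case 1
  then show ?case by (simp add: path_chain_def)
next
  case (2 p)
  then show ?case using segment_path_length[of T p] by (simp add: path_chain_single)
next
  case (3 p q ps)
  have c: "segment_path T p" "path_chain T (q # ps)" using "3.prems" path_chain_Cons[of "q # ps"] by auto
  have "join_paths (p # q # ps) = p @ tl (join_paths (q # ps))"
    using path_chain_hd(1)[OF c(2)] by (intro join_paths_Cons) auto
  moreover have "2 \<le> length (join_paths (q # ps))"
    "last (join_paths (q # ps)) = last (last (q # ps))" using "3.IH"(2)[OF c(2)] by auto
  ultimately show ?case
    using segment_path_length[OF c(1)] by (auto simp: last_append last_tl Suc_le_length_iff numeral_2_eq_2
      simp del: join_paths.simps)
qed

lemma path_chain_join_Cons:
  assumes "path_chain T qs"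
  obtains ys where "join_paths qs = hd (hd qs) # ys" "ys \<noteq> []"
  using path_chain_hd(2,3)[OF assms] path_chain_last[OF assms]
  by (cases "join_paths qs") force+

lemma successively_nth:
  "successively P xs \<longleftrightarrow> (\<forall>i. Suc i < length xs \<longrightarrow> P (xs ! i) (xs ! Suc i))"
proof (induction P xs rule: successively.induct)
  case (3 P x y xs)
  then show ?case by (auto simp: All_less_Suc2 nth_Cons split: nat.splits)
qed auto

lemma composes_iff:
  "composes T ss s \<longleftrightarrow>
    (\<exists>ps. path_chain T ps \<and> map set ps = ss \<and> segment_path T (join_paths ps) \<and> s = set (join_paths ps))"
proof -
  have *: "list_all2 (\<lambda>p r. segment_path T p \<and> set p = r) ps ss \<longleftrightarrow>
      (\<forall>p\<in>set ps. segment_path T p) \<and> map set ps = ss" for ps ss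
    by (induction ps arbitrary: ss) (auto simp: list_all2_Cons1 Cons_eq_map_conv)
  have **: "hd ps @ concat (map tl (tl ps)) = join_paths ps" if "ps \<noteq> []" for ps :: "'a list list"
    using that by (cases ps) auto
  show ?thesis
    unfolding composes_def * path_chain_def successively_nth
    using ** by (metis map_is_Nil_conv)
qed

text \<open>Peel off the first path: the join of the others is a suffix of a segment path, hence a
  segment itself, and what remains is a binary composition.\<close>

lemma path_chain_set:
  assumes "seg_closed T X"
  shows "path_chain T ps \<Longrightarrow> segment_path T (join_paths ps) \<Longrightarrow> set ` set ps \<subseteq> X \<Longrightarrow>
    set (join_paths ps) \<in> X"
proof (induction ps rule: induct_list012)
  case 1
  then show ?case by (simp add: path_chain_def)
next
  case (2 p)
  then show ?case by simp
next
  case (3 p q ps)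
  have c: "segment_path T p" "path_chain T (q # ps)" "last p = hd q"
    using "3.prems" path_chain_Cons[of "q # ps"] by auto
  have j: "join_paths (p # q # ps) = p @ tl (join_paths (q # ps))"
    using path_chain_hd(1)[OF c(2)] by (intro join_paths_Cons) auto
  obtain xs b where p: "p = xs @ [b]" "xs \<noteq> []"
    using segment_path_length[OF c(1)] by (cases p rule: rev_cases) (auto simp: Suc_le_eq)
  obtain ys where q: "join_paths (q # ps) = b # ys" "ys \<noteq> []"
    using path_chain_join_Cons[OF c(2)] c(3) p(1) by auto
  have sp: "segment_path T (xs @ b # ys)" using "3.prems"(2) unfolding j unfolding p q by simp
  have "set (b # ys) \<in> X"
    using "3.IH"(2)[OF c(2)] "3.prems"(3) segment_path_suffix[OF sp q(2)] unfolding q by simp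
  moreover have "set (xs @ [b]) \<in> X" using "3.prems"(3) p by simp
  moreover have "glue T (set (xs @ [b])) (set (b # ys)) (set (xs @ b # ys))"
    using glueI[OF sp p(2) q(2)] by blast
  ultimately have "set (xs @ b # ys) \<in> X" using assms unfolding seg_closed_iff by blast
  then show ?case unfolding j unfolding p q by simp
qed

lemma composes_closed:
  "composes T ss u \<Longrightarrow> set ss \<subseteq> X \<Longrightarrow> seg_closed T X \<Longrightarrow> u \<in> X"
  unfolding composes_iff using path_chain_set by (metis image_set)

text \<open>Induction compares \<open>b\<close> with the first junction. A cut at a junction will
  give faultline splits; a cut strictly inside one path is the source of the non-faultline
  ones.\<close>

lemma join_paths_split:
  assumes "path_chain T ps" "join_paths ps = xs @ b # ys" "xs \<noteq> []" "ys \<noteq> []"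
  shows "(\<exists>j. 1 \<le> j \<and> j < length ps \<and> join_paths (take j ps) = xs @ [b] \<and> join_paths (drop j ps) = b # ys) \<or>
    (\<exists>j xs' ys'. j < length ps \<and> xs' \<noteq> [] \<and> ys' \<noteq> [] \<and> ps ! j = xs' @ b # ys' \<and>
      join_paths (take j ps @ [xs' @ [b]]) = xs @ [b] \<and>
      join_paths ((b # ys') # drop (Suc j) ps) = b # ys)"
  using assms
proof (induction ps arbitrary: xs rule: induct_list012)
  case 1
  then show ?case by simp
next
  case (2 p)
  then show ?case by (intro disjI2 exI[of _ 0] exI[of _ xs] exI[of _ ys]) auto
next
  case (3 p q ps)
  have c: "segment_path T p" "path_chain T (q # ps)" "last p = hd q"
    using "3.prems" path_chain_Cons[of "q # ps"] by auto
  have q0: "q \<noteq> []" using path_chain_hd(1)[OF c(2)] by simp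
  have j: "join_paths (p # q # ps) = p @ tl (join_paths (q # ps))"
    using q0 by (intro join_paths_Cons) auto
  obtain us e where p: "p = us @ [e]" "us \<noteq> []"
    using segment_path_length[OF c(1)] by (cases p rule: rev_cases) (auto simp: Suc_le_eq)
  obtain vs where q: "join_paths (q # ps) = e # vs" "vs \<noteq> []"
    using path_chain_join_Cons[OF c(2)] c(3) p(1) by auto
  have eq: "us @ e # vs = xs @ b # ys" using "3.prems"(2) unfolding j unfolding p q by simp
  then show ?case
  proof (cases rule: append_Cons_eq_append_ConsE)
    case 1
    then show ?thesis using p q by (intro disjI1 exI[of _ 1]) auto
  next
    case (2 zs)
    have "join_paths ((b # zs @ [e]) # q # ps) = (b # zs @ [e]) @ tl (join_paths (q # ps))"
      using q0 by (intro join_paths_Cons) auto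
    then have "join_paths ((b # zs @ [e]) # q # ps) = b # ys" using 2 q by simp
    then show ?thesis
      using 2 p "3.prems" by (intro disjI2 exI[of _ 0] exI[of _ xs] exI[of _ "zs @ [e]"]) auto
  next
    case (3 zs)
    \<comment> \<open>Prepending \<open>p\<close> turns a decomposition of the tail, which starts at
      the junction \<open>e\<close>, into one of the whole chain.\<close>
    have J: "join_paths (p # Q) = xs @ [b]" if "Q \<noteq> []" "hd Q \<noteq> []" "join_paths Q = (e # zs) @ [b]" for Q
      using join_paths_Cons[OF that(1,2), of p] that(3) p 3 by simp
    have "join_paths (q # ps) = (e # zs) @ b # ys" using q 3 by simp
    from "3.IH"(2)[OF c(2) this list.distinct(2) "3.prems"(4)] show ?thesis
    proof (elim disjE exE conjE)
      fix j assume h: "1 \<le> j" "j < length (q # ps)" "join_paths (take j (q # ps)) = (e # zs) @ [b]"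
        "join_paths (drop j (q # ps)) = b # ys"
      have "join_paths (p # take j (q # ps)) = xs @ [b]"
        using h(1,3) q0 by (intro J) (cases j; auto)+
      then show ?thesis using h by (intro disjI1 exI[of _ "Suc j"]) auto
    next
      fix j xs' ys' assume h: "j < length (q # ps)" "xs' \<noteq> []" "ys' \<noteq> []" "(q # ps) ! j = xs' @ b # ys'"
        "join_paths (take j (q # ps) @ [xs' @ [b]]) = (e # zs) @ [b]"
        "join_paths ((b # ys') # drop (Suc j) (q # ps)) = b # ys"
      have "join_paths (p # take j (q # ps) @ [xs' @ [b]]) = xs @ [b]"
        using h(5) q0 by (intro J) (cases j; auto)+
      then show ?thesis
        using h by (intro disjI2 exI[of _ "Suc j"] exI[of _ xs'] exI[of _ ys']) auto
    qed
  qed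
qed

section \<open>Associativity, refinement and uniqueness of cuts in a tree\<close>

locale segment_tree =
  fixes T :: "'v plane_tree"
  assumes tree: "is_tree T"
begin

text \<open>The path hidden in \<open>glue\<close> agrees with \<open>p\<close> up to reversal, so
  any orientation of \<open>w\<close> may be prescribed; the price is not knowing which part comes
  first.\<close>

lemma glue_on_path:
  assumes "glue T u v w" "segment_path T p" "set p = w"
  obtains xs b ys where "xs \<noteq> []" "ys \<noteq> []" "p = xs @ b # ys"
    "u = set (xs @ [b]) \<and> v = set (b # ys) \<or> v = set (xs @ [b]) \<and> u = set (b # ys)"
proof -
  obtain xs b ys where
    *: "xs \<noteq> []" "ys \<noteq> []" "segment_path T (xs @ b # ys)" "u = set (xs @ [b])"
       "v = set (b # ys)" "w = set (xs @ b # ys)"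
    using assms unfolding glue_def by blast
  have "p = xs @ b # ys \<or> p = rev (xs @ b # ys)"
    using tree_path_unique[OF tree *(3) assms(2)] assms(3) *(6) by blast
  then show thesis
  proof
    assume "p = xs @ b # ys"
    then show thesis using that * by blast
  next
    assume "p = rev (xs @ b # ys)"
    then show thesis using that[of "rev ys" "rev xs" b] * by auto
  qed
qed

text \<open>Associativity for undirected segments: \<open>v'\<close> is whichever of
  \<open>u\<close> and \<open>v\<close> touches \<open>t\<close>.\<close>

lemma glue_assoc:
  assumes "glue T u v s" "glue T s t r"
  obtains u' v' y where "u' = u \<and> v' = v \<or> u' = v \<and> v' = u" "glue T v' t y" "glue T u' y r"
proof -
  obtain xs b ys where
    *: "xs \<noteq> []" "ys \<noteq> []" "segment_path T (xs @ b # ys)" "s = set (xs @ [b])"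
       "t = set (b # ys)" "r = set (xs @ b # ys)"
    using assms unfolding glue_def by blast
  have "segment_path T (xs @ [b])" using * segment_path_prefix by metis
  from glue_on_path[OF assms(1) this] *(4) obtain us c vs where
    **: "us \<noteq> []" "vs \<noteq> []" "xs @ [b] = us @ c # vs"
      "u = set (us @ [c]) \<and> v = set (c # vs) \<or> v = set (us @ [c]) \<and> u = set (c # vs)"
    by metis
  obtain zs where zs: "vs = zs @ [b]" "xs = us @ c # zs"
    using **(2,3) by (cases vs rule: rev_cases) auto
  have p: "segment_path T (us @ c # zs @ b # ys)" using * zs by simp
  then have "segment_path T ((c # zs) @ b # ys)" using segment_path_suffix[of T us c "zs @ b # ys"] by simp
  from glueI[OF this] have y: "glue T (set (c # vs)) t (set (c # zs @ b # ys))"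
    using * zs by simp
  have r: "glue T (set (us @ [c])) (set (c # zs @ b # ys)) r"
    using glueI[OF p] * ** zs by simp
  show thesis using that y r **(4) by metis
qed

text \<open>The two cut vertices coincide, or one precedes the other along a common orientation; in
  the latter cases \<open>m\<close> is the stretch between them.\<close>

lemma glue_refine:
  assumes "glue T s t r" "glue T u v r"
  obtains u' v' where "u' = u \<and> v' = v \<or> u' = v \<and> v' = u"
    "u' = s \<and> v' = t \<or> (\<exists>m. glue T u' m s \<and> glue T m t v') \<or> (\<exists>m. glue T s m u' \<and> glue T m v' t)"
proof -
  obtain xs b ys where
    *: "xs \<noteq> []" "ys \<noteq> []" "segment_path T (xs @ b # ys)" "s = set (xs @ [b])"
       "t = set (b # ys)" "r = set (xs @ b # ys)"
    using assms unfolding glue_def by blast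
  obtain us c vs u' v' where
    **: "us \<noteq> []" "vs \<noteq> []" "xs @ b # ys = us @ c # vs"
      "u' = u \<and> v' = v \<or> u' = v \<and> v' = u" "u' = set (us @ [c])" "v' = set (c # vs)"
    using glue_on_path[OF assms(2) *(3)] *(6) by metis
  have step: "glue T (set (as @ [d])) (set (d # zs @ [e])) (set (as @ d # zs @ [e])) \<and>
      glue T (set (d # zs @ [e])) (set (e # bs)) (set (d # zs @ e # bs))"
    if p: "segment_path T (as @ d # zs @ e # bs)" and "as \<noteq> []" "bs \<noteq> []" for as d zs e bs
  proof -
    have "segment_path T (as @ d # zs @ [e])" using p segment_path_prefix[of T "as @ d # zs" e bs] by simp
    moreover have "segment_path T ((d # zs) @ e # bs)" using p segment_path_suffix[of T as d "zs @ e # bs"] by simp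
    ultimately show ?thesis
      using glueI[of T as d "zs @ [e]"] glueI[of T "d # zs" e bs] that(2,3) by simp
  qed
  from **(3) have "u' = s \<and> v' = t \<or> (\<exists>m. glue T u' m s \<and> glue T m t v') \<or> (\<exists>m. glue T s m u' \<and> glue T m v' t)"
  proof (cases rule: append_Cons_eq_append_ConsE)
    case 1
    then show ?thesis using * ** by simp
  next
    case (2 zs)
    then show ?thesis using step[of us c zs b ys] * ** by auto
  next
    case (3 zs)
    then show ?thesis using step[of xs b zs c vs] * ** by auto
  qed
  then show thesis using that **(4) by blast
qed

text \<open>\<open>u\<close> contains the first vertex of the oriented path, which forces it to be
  the initial part in both breaks; distinctness then fixes the cut vertex.\<close>

lemma glue_unique:
  assumes "glue T u v t" "glue T u v' t"
  shows "v = v'"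
proof -
  obtain xs b ys where
    *: "xs \<noteq> []" "ys \<noteq> []" "segment_path T (xs @ b # ys)" "u = set (xs @ [b])"
       "v = set (b # ys)" "t = set (xs @ b # ys)"
    using assms(1) unfolding glue_def by blast
  obtain us c vs where
    **: "us \<noteq> []" "vs \<noteq> []" "xs @ b # ys = us @ c # vs"
      "u = set (us @ [c]) \<and> v' = set (c # vs) \<or> v' = set (us @ [c]) \<and> u = set (c # vs)"
    using glue_on_path[OF assms(2) *(3)] *(6) by metis
  have d: "distinct (xs @ b # ys)" using * segment_path_distinct by blast
  have u: "u = set (us @ [c])" and v': "v' = set (c # vs)"
  proof -
    have "hd (us @ c # vs) \<in> u" using *(1,4) **(3)[symmetric] by auto
    moreover have "hd (us @ c # vs) \<notin> set (c # vs)"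
      using d **(1) unfolding **(3) by (cases us) auto
    ultimately show "u = set (us @ [c])" "v' = set (c # vs)" using **(4) by auto
  qed
  from **(3) show ?thesis
  proof (cases rule: append_Cons_eq_append_ConsE)
    case 1
    then show ?thesis using * v' by simp
  next
    case (2 zs)
    then show ?thesis using d * u by auto
  next
    case (3 zs)
    then show ?thesis using d * u by auto
  qed
qed

text \<open>A subsegment is an infix of the path. Sharing an endpoint means that nothing is left
  over on one side, and the remainder on the other side, together with the cut vertex, is
  \<open>v\<close>.\<close>

lemma is_split_iff: "is_split T u t \<longleftrightarrow> (\<exists>v. glue T u v t)"
proof
  assume a: "is_split T u t"
  then obtain p q where p: "segment_path T p" "t = set p" and q: "segment_path T q" "u = set q"
    and ut: "u \<subset> t" and e: "endpoints T u \<inter> endpoints T t \<noteq> {}"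
    unfolding is_split_def Seg_def by blast
  obtain xs ys where "p = xs @ q @ ys \<or> p = xs @ rev q @ ys"
    using tree_subpath[OF tree p(1) q(1)] p q ut by blast
  then obtain q' where q': "segment_path T q'" "u = set q'" "p = xs @ q' @ ys"
    using q segment_path_rev[OF q(1)] by auto
  have d: "distinct p" using p segment_path_distinct by blast
  have ne: "q' \<noteq> []" using segment_path_length[OF q'(1)] by auto
  have "{hd p, last p} \<inter> {hd q', last q'} \<noteq> {}"
    using e tree_endpoints[OF tree p(1)] tree_endpoints[OF tree q'(1)] p q' by auto
  moreover have "hd p \<notin> set q'" if "xs \<noteq> []" using that d q'(3) by (cases xs) auto
  moreover have "last p \<notin> set q'" if "ys \<noteq> []" using that d q'(3) by (cases ys rule: rev_cases) auto
  moreover have "hd q' \<in> set q'" "last q' \<in> set q'" using ne by auto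
  ultimately have "xs = [] \<or> ys = []" by (metis Int_emptyI insert_iff singletonD)
  moreover have "\<not> (xs = [] \<and> ys = [])" using ut p q' by auto
  moreover have "\<exists>v. glue T u v t" if "xs = []" "ys \<noteq> []"
  proof -
    obtain zs b where z: "q' = zs @ [b]" using ne by (cases q' rule: rev_cases) auto
    have "zs \<noteq> []" using segment_path_length[OF q'(1)] z by auto
    then show ?thesis using that z p q' by (intro exI glueI[of T zs b ys]) auto
  qed
  moreover have "\<exists>v. glue T u v t" if "xs \<noteq> []" "ys = []"
  proof -
    obtain zs b where z: "q' = b # zs" using ne by (cases q') auto
    have "zs \<noteq> []" using segment_path_length[OF q'(1)] z by auto
    then have "glue T (set (xs @ [b])) u t" using that z p q' by (intro glueI[of T xs b zs]) auto
    then show ?thesis using glue_commute by blast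
  qed
  ultimately show "\<exists>v. glue T u v t" by blast
next
  assume "\<exists>v. glue T u v t"
  then obtain v where g: "glue T u v t" by blast
  then obtain xs b ys where
    *: "xs \<noteq> []" "ys \<noteq> []" "segment_path T (xs @ b # ys)" "u = set (xs @ [b])"
       "v = set (b # ys)" "t = set (xs @ b # ys)"
    unfolding glue_def by blast
  have "segment_path T (xs @ [b])" using * segment_path_prefix by metis
  then have "hd xs \<in> endpoints T u \<inter> endpoints T t"
    using tree_endpoints[OF tree, of "xs @ [b]"] tree_endpoints[OF tree *(3)] * by auto
  then show "is_split T u t"
    unfolding is_split_def using glue_Seg[OF g] glue_subset[OF g] by blast
qed

section \<open>Biclosed sets and covers\<close>

lemma Seg_subset_verts: "s \<in> Seg T \<Longrightarrow> s \<subseteq> verts T"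
  by (auto simp: Seg_def segment_path_def walk_def)

lemma finite_Seg: "finite (Seg T)"
proof (rule finite_subset)
  show "Seg T \<subseteq> Pow (verts T)" using Seg_subset_verts by blast
  show "finite (Pow (verts T))" using tree by (simp add: is_tree_def)
qed

lemma card_glue:
  assumes "glue T u v w"
  shows "card u < card w" "card v < card w"
proof -
  have "finite w"
    using glue_Seg(3)[OF assms] Seg_subset_verts tree finite_subset unfolding is_tree_def by metis
  then show "card u < card w" "card v < card w"
    using glue_subset[OF assms] by (auto intro: psubset_card_mono)
qed

lemma Bic_iff:
  "B \<in> Bic T \<longleftrightarrow> B \<subseteq> Seg T \<and> (\<forall>u v w. glue T u v w \<longrightarrow> u \<in> B \<longrightarrow> v \<in> B \<longrightarrow> w \<in> B) \<and>
     (\<forall>u v w. glue T u v w \<longrightarrow> w \<in> B \<longrightarrow> u \<in> B \<or> v \<in> B)"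
proof -
  have "(\<forall>u v w. u \<in> Seg T - B \<longrightarrow> v \<in> Seg T - B \<longrightarrow> glue T u v w \<longrightarrow> w \<in> Seg T - B) \<longleftrightarrow>
      (\<forall>u v w. glue T u v w \<longrightarrow> w \<in> B \<longrightarrow> u \<in> B \<or> v \<in> B)"
    by (metis Diff_iff glue_Seg)
  then show ?thesis
    unfolding Bic_def seg_closed_iff mem_Collect_eq by (simp only: Diff_subset) blast
qed

lemma Bic_Seg: "B \<in> Bic T \<Longrightarrow> B \<subseteq> Seg T"
  and Bic_closed: "B \<in> Bic T \<Longrightarrow> glue T u v w \<Longrightarrow> u \<in> B \<Longrightarrow> v \<in> B \<Longrightarrow> w \<in> B"
  and Bic_coclosed: "B \<in> Bic T \<Longrightarrow> glue T u v w \<Longrightarrow> w \<in> B \<Longrightarrow> u \<in> B \<or> v \<in> B"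
  by (simp_all add: Bic_iff)

lemma Bic_compl:
  assumes "B \<in> Bic T"
  shows "Seg T - B \<in> Bic T"
proof -
  have "Seg T - (Seg T - B) = B" using Bic_Seg[OF assms] by blast
  then show ?thesis using assms by (simp only: Bic_def mem_Collect_eq)
qed

text \<open>A segment of \<open>Z - W\<close> of minimal size can be added to \<open>W\<close> without destroying coclosedness;
  among all segments with this property, one of maximal size also preserves closedness.\<close>

lemma Bic_insert_exists:
  assumes W: "W \<in> Bic T" and Z: "Z \<in> Bic T" and WZ: "W \<subset> Z"
  obtains s where "s \<in> Z - W" "insert s W \<in> Bic T"
proof -
  define G where "G = {s \<in> Z - W. \<forall>u v. glue T u v s \<longrightarrow> u \<in> W \<or> v \<in> W}"
  have finG: "finite G"
    using finite_subset[OF _ finite_Seg, of G] Bic_Seg[OF Z] by (auto simp: G_def)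
  have "\<exists>s. s \<in> Z - W \<and> (\<forall>y. y \<in> Z - W \<longrightarrow> card s \<le> card y)"
    using ex_has_least_nat[of "\<lambda>s. s \<in> Z - W" _ card] WZ by blast
  then obtain s0 where s0: "s0 \<in> Z - W" "\<And>y. y \<in> Z - W \<Longrightarrow> card s0 \<le> card y" by blast
  have "u \<in> W \<or> v \<in> W" if g: "glue T u v s0" for u v
    using Bic_coclosed[OF Z g] s0(1) s0(2)[of u] s0(2)[of v] card_glue[OF g] by auto
  then have "s0 \<in> G" using s0(1) by (simp add: G_def)
  then have "Max (card ` G) \<in> card ` G" using finG by (intro Max_in) auto
  then obtain s where "s \<in> G" "Max (card ` G) = card s" by blast
  then have s: "s \<in> G" "\<And>y. y \<in> G \<Longrightarrow> card y \<le> card s"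
    using finG by (metis Max_ge finite_imageI imageI)+
  have sW: "s \<in> Z" "s \<notin> W" and good: "\<And>u v. glue T u v s \<Longrightarrow> u \<in> W \<or> v \<in> W"
    using s(1) by (auto simp: G_def)
  \<comment> \<open>Take \<open>t\<close> of minimal size among the counterexamples. Every break of
    \<open>r\<close> turns out to have a part in \<open>W\<close>, so \<open>r\<close> belongs to
    \<open>G\<close>, contradicting the maximal size of \<open>s\<close>.\<close>
  have closed: "r \<in> W" if t: "t \<in> W" "glue T s t r" for t r
  proof (rule ccontr)
    assume "r \<notin> W"
    then have "\<exists>t. t \<in> W \<and> (\<exists>r. glue T s t r \<and> r \<notin> W)" using t by blast
    then obtain t where "t \<in> W" "\<exists>r. glue T s t r \<and> r \<notin> W"
      and min: "\<And>t'. t' \<in> W \<Longrightarrow> \<exists>r. glue T s t' r \<and> r \<notin> W \<Longrightarrow> card t \<le> card t'"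
      using ex_has_least_nat[of "\<lambda>t. t \<in> W \<and> (\<exists>r. glue T s t r \<and> r \<notin> W)" _ card] by blast
    then obtain r where t: "t \<in> W" "glue T s t r" "r \<notin> W" by blast
    have "u \<in> W \<or> v \<in> W" if uvr: "glue T u v r" for u v
    proof -
      obtain u' v' where uv: "u' = u \<and> v' = v \<or> u' = v \<and> v' = u" and
        c: "u' = s \<and> v' = t \<or> (\<exists>m. glue T u' m s \<and> glue T m t v') \<or> (\<exists>m. glue T s m u' \<and> glue T m v' t)"
        using glue_refine[OF t(2) uvr] by blast
      have "u' \<in> W \<or> v' \<in> W"
      proof -
        {
          fix m assume m: "glue T u' m s" "glue T m t v'"
          have ?thesis using good[OF m(1)] Bic_closed[OF W m(2)] t(1) by blast
        }
        moreover {
          \<comment> \<open>Coclosedness at \<open>t\<close> gives \<open>v'\<close> or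
            \<open>m\<close> in \<open>W\<close>; in the second case \<open>m\<close> is smaller
            than \<open>t\<close>, so minimality of \<open>t\<close> puts \<open>u'\<close> into
            \<open>W\<close>.\<close>
          fix m assume m: "glue T s m u'" "glue T m v' t"
          have ?thesis
            using Bic_coclosed[OF W m(2) t(1)] min[of m] m(1) card_glue(1)[OF m(2)] by force
        }
        ultimately show ?thesis using c t(1) by blast
      qed
      with uv show ?thesis by blast
    qed
    moreover have "r \<in> Z" using Bic_closed[OF Z t(2)] sW(1) t(1) WZ by blast
    ultimately have "r \<in> G" using t(3) by (simp add: G_def)
    then show False using s(2) card_glue(1)[OF t(2)] by force
  qed
  have ss: "\<not> glue T s s r" for r using glue_subset(3) by blast
  have "insert s W \<in> Bic T"
    unfolding Bic_iff
  proof (intro conjI allI impI)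
    show "insert s W \<subseteq> Seg T" using Bic_Seg[OF W] Bic_Seg[OF Z] sW by blast
  next
    fix u v w assume g: "glue T u v w" and uv: "u \<in> insert s W" "v \<in> insert s W"
    show "w \<in> insert s W"
      using uv closed[of v w] closed[of u w] g glue_commute[OF g] ss Bic_closed[OF W g] by auto
  next
    fix u v w assume g: "glue T u v w" and w: "w \<in> insert s W"
    show "u \<in> insert s W \<or> v \<in> insert s W"
      using w good[of u v] Bic_coclosed[OF W g] g by auto
  qed
  then show thesis using that sW by blast
qed

text \<open>The one-element extension from \<open>Bic_insert_exists\<close> lies in the cover, so it
  exhausts it. This is what makes \<open>the_elem\<close> in \<open>label\<close>
  meaningful.\<close>

lemma bic_covers_insert:
  assumes "bic_covers T W Z"
  obtains s where "s \<notin> W" "Z = insert s W"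
proof -
  have *: "W \<in> Bic T" "Z \<in> Bic T" "W \<subset> Z" "\<not> (\<exists>X\<in>Bic T. W \<subset> X \<and> X \<subset> Z)"
    using assms by (auto simp: bic_covers_def)
  obtain s where s: "s \<in> Z - W" "insert s W \<in> Bic T" using Bic_insert_exists[OF *(1-3)] .
  then have "\<not> insert s W \<subset> Z" using * by blast
  then show thesis using that[of s] s * by blast
qed

lemma bic_covers_insertI:
  "W \<in> Bic T \<Longrightarrow> insert s W \<in> Bic T \<Longrightarrow> s \<notin> W \<Longrightarrow> bic_covers T W (insert s W)"
  unfolding bic_covers_def by blast

lemma seg_closure_subset:
  "S \<subseteq> X \<Longrightarrow> seg_closed T X \<Longrightarrow> seg_closure T S \<subseteq> X"
  unfolding seg_closure_def by (rule hull_minimal)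

lemma subset_seg_closure: "S \<subseteq> seg_closure T S"
  unfolding seg_closure_def by (rule hull_subset)

lemma seg_closure_glue:
  "glue T u v w \<Longrightarrow> u \<in> seg_closure T S \<Longrightarrow> v \<in> seg_closure T S \<Longrightarrow> w \<in> seg_closure T S"
  unfolding seg_closure_def hull_def seg_closed_iff by blast

lemma seg_closure_Seg: "S \<subseteq> Seg T \<Longrightarrow> seg_closure T S \<subseteq> Seg T"
  by (rule seg_closure_subset) (auto simp: seg_closed_iff glue_Seg)

text \<open>Intersecting \<open>P\<close> with the closure before using minimality allows the step
  to assume that both parts already lie in the closure.\<close>

lemma seg_closure_induct [consumes 2, case_names base glue]:
  assumes "x \<in> seg_closure T S" "S \<subseteq> Seg T"
    and "\<And>x. x \<in> S \<Longrightarrow> P x"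
    and "\<And>u v w. glue T u v w \<Longrightarrow> u \<in> seg_closure T S \<Longrightarrow> v \<in> seg_closure T S \<Longrightarrow> P u \<Longrightarrow> P v \<Longrightarrow> P w"
  shows "P x"
proof -
  have "seg_closure T S \<subseteq> {x \<in> seg_closure T S. P x}"
  proof (rule seg_closure_subset)
    show "S \<subseteq> {x \<in> seg_closure T S. P x}" using assms(3) subset_seg_closure by blast
    show "seg_closed T {x \<in> seg_closure T S. P x}"
      unfolding seg_closed_iff using assms(4) seg_closure_glue seg_closure_Seg[OF assms(2)] by blast
  qed
  then show ?thesis using assms(1) by blast
qed

text \<open>The orientation \<open>p\<close> varies in the induction: the parts inherit theirs from
  \<open>p\<close>, and either part may come first on it.\<close>

lemma closure_path_chain:
  assumes "x \<in> seg_closure T S" "S \<subseteq> Seg T" "segment_path T p" "set p = x"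
  obtains ps where "path_chain T ps" "join_paths ps = p" "set ` set ps \<subseteq> S"
proof -
  have "\<exists>ps. path_chain T ps \<and> join_paths ps = p \<and> set ` set ps \<subseteq> S"
    using assms
  proof (induction x arbitrary: p rule: seg_closure_induct)
    case (base x)
    then show ?case by (intro exI[of _ "[p]"]) (simp add: path_chain_single)
  next
    case (glue u v w)
    obtain xs b ys where p: "xs \<noteq> []" "ys \<noteq> []" "p = xs @ b # ys"
      "u = set (xs @ [b]) \<and> v = set (b # ys) \<or> v = set (xs @ [b]) \<and> u = set (b # ys)"
      by (rule glue_on_path[OF glue.hyps(1) glue.prems])
    have sp: "segment_path T (xs @ [b])" "segment_path T (b # ys)"
      using glue.prems(1) p segment_path_prefix segment_path_suffix by metis+
    obtain ps where ps: "path_chain T ps" "join_paths ps = xs @ [b]" "set ` set ps \<subseteq> S"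
      using glue.IH(1)[OF sp(1)] glue.IH(2)[OF sp(1)] p(4) by blast
    obtain qs where qs: "path_chain T qs" "join_paths qs = b # ys" "set ` set qs \<subseteq> S"
      using glue.IH(1)[OF sp(2)] glue.IH(2)[OF sp(2)] p(4) by blast
    have ne: "ps \<noteq> []" "qs \<noteq> []" using ps(1) qs(1) by (auto simp: path_chain_def)
    have "last (last ps) = hd (hd qs)"
      using path_chain_last[OF ps(1)] path_chain_hd(3)[OF qs(1)] ps(2) qs(2) by simp
    then have "path_chain T (ps @ qs)" using path_chain_append[OF ne] ps(1) qs(1) by blast
    moreover have "join_paths (ps @ qs) = p"
      using join_paths_append[OF ne path_chain_hd(1)[OF qs(1)]] ps(2) qs(2) p(3) by simp
    ultimately show ?case using ps(3) qs(3) by (metis image_Un le_sup_iff set_append)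
  qed
  then show thesis using that by blast
qed

lemma glue_neq: "glue T u v w \<Longrightarrow> u \<noteq> v"
  using glue_subset(3) by blast

text \<open>\<open>f\<close> sends a split to the break containing it. If no break is used twice,
  \<open>f\<close> is injective on \<open>E\<close>, and since there are finitely many breaks, equal
  cardinality means that every break is hit. This turns counting into a condition on each break
  separately.\<close>

lemma one_split_per_break:
  assumes E: "\<And>u. u \<in> E \<Longrightarrow> is_split T u t"
  shows "card E = card (breaks T t) \<and>
      (\<forall>u1\<in>E. \<forall>u2\<in>E. u1 \<noteq> u2 \<longrightarrow> \<not> (\<exists>b\<in>breaks T t. u1 \<in> b \<and> u2 \<in> b)) \<longleftrightarrow>
    (\<forall>u v. glue T u v t \<longrightarrow> (u \<in> E \<longleftrightarrow> v \<notin> E))" (is "?card \<and> ?one \<longleftrightarrow> ?R")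
proof -
  define f where "f u = {u, THE v. glue T u v t}" for u
  have f: "f u = {u, v}" if "glue T u v t" for u v
    unfolding f_def using glue_unique[OF that] that by (metis (no_types, lifting) the_equality)
  have fE: "f ` E \<subseteq> breaks T t"
  proof
    fix b assume "b \<in> f ` E"
    then obtain u where "u \<in> E" "b = f u" by blast
    moreover obtain v where g: "glue T u v t" using E[OF \<open>u \<in> E\<close>] is_split_iff by blast
    ultimately have "b = {u, v}" using f[OF g] by simp
    then show "b \<in> breaks T t" unfolding breaks_eq using g by blast
  qed
  have finb: "finite (breaks T t)"
  proof (rule finite_subset)
    show "breaks T t \<subseteq> Pow (Seg T)" unfolding breaks_eq using glue_Seg by blast
  qed (simp add: finite_Seg)
  have self: "u \<in> f u" for u by (simp add: f_def)
  have inj: "inj_on f E" if ?one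
  proof (rule inj_onI)
    fix u v assume uv: "u \<in> E" "v \<in> E" "f u = f v"
    have "f u \<in> breaks T t" "u \<in> f u" "v \<in> f u" using fE uv self[of u] self[of v] by auto
    then show "u = v" using that uv(1,2) by blast
  qed
  show ?thesis
  proof
    assume h: "?card \<and> ?one"
    then have "f ` E = breaks T t"
      using inj fE finb by (metis card_image card_subset_eq)
    show ?R
    proof (intro allI impI)
      fix u v assume g: "glue T u v t"
      then have b: "{u, v} \<in> breaks T t" unfolding breaks_eq by blast
      then obtain e where "e \<in> E" "f e = {u, v}" using \<open>f ` E = breaks T t\<close> by (metis imageE)
      then have "u \<in> E \<or> v \<in> E" using self[of e] by auto
      moreover have "\<exists>b\<in>breaks T t. u \<in> b \<and> v \<in> b"
        using b by (intro bexI[of _ "{u, v}"]) auto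
      then have "\<not> (u \<in> E \<and> v \<in> E)" using h glue_neq[OF g] by meson
      ultimately show "u \<in> E \<longleftrightarrow> v \<notin> E" by blast
    qed
  next
    assume R: ?R
    have one: ?one
    proof (intro ballI impI notI)
      fix u1 u2 assume u: "u1 \<in> E" "u2 \<in> E" "u1 \<noteq> u2" and "\<exists>b\<in>breaks T t. u1 \<in> b \<and> u2 \<in> b"
      then obtain a b where g: "glue T a b t" and "u1 \<in> {a, b}" "u2 \<in> {a, b}"
        unfolding breaks_eq by blast
      then have "a \<in> E \<and> b \<in> E" using u by auto
      then show False using R[rule_format, OF g] by simp
    qed
    have "breaks T t \<subseteq> f ` E"
    proof
      fix b assume "b \<in> breaks T t"
      then obtain u v where b: "b = {u, v}" "glue T u v t" unfolding breaks_eq by blast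
      then have "b = f u" "b = f v" using f[of u v] f[of v u] glue_commute[OF b(2)] by auto
      then show "b \<in> f ` E" using R[rule_format, OF b(2)] by blast
    qed
    then have "f ` E = breaks T t" using fE by blast
    then show "?card \<and> ?one" using one card_image[OF inj[OF one]] by metis
  qed
qed

section \<open>The interval below a biclosed set\<close>

text \<open>In the application \<open>C\<close> is the complement of \<open>B\<close>, and
  \<open>insert s C\<close> is the complement of the lower cover of \<open>B\<close> with label
  \<open>s\<close>.\<close>

context
  fixes C S :: "'v set set"
  assumes C: "C \<in> Bic T" and SC: "S \<inter> C = {}" and insert_C: "\<And>s. s \<in> S \<Longrightarrow> insert s C \<in> Bic T"
begin

lemma S_Seg: "S \<subseteq> Seg T"
  using insert_C Bic_Seg by blast

lemma closure_disjoint: "seg_closure T S \<inter> C = {}"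
proof -
  have "seg_closure T S \<subseteq> Seg T - C"
    using Bic_compl[OF C] SC S_Seg by (intro seg_closure_subset) (auto simp: Bic_def)
  then show ?thesis by blast
qed

text \<open>For \<open>x\<close> in \<open>S\<close> the result lies in \<open>insert x C\<close> by
  closedness and is larger than \<open>x\<close>. A composed \<open>x\<close> absorbs its two parts
  one after the other, the part next to \<open>c\<close> first.\<close>

lemma closure_absorb:
  assumes "x \<in> seg_closure T S" "c \<in> C" "glue T x c r"
  shows "r \<in> C"
  using assms(1) S_Seg assms(2,3)
proof (induction x arbitrary: c r rule: seg_closure_induct)
  case (base x)
  then have "r \<in> insert x C" using Bic_closed[OF insert_C] by blast
  then show ?case using glue_subset(1)[OF base.prems(2)] by blast
next
  case (glue u v w)
  obtain u' v' y where "u' = u \<and> v' = v \<or> u' = v \<and> v' = u" "glue T v' c y" "glue T u' y r"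
    using glue_assoc[OF glue.hyps(1) glue.prems(2)] by blast
  then show ?case using glue.IH glue.prems(1) by blast
qed

text \<open>For \<open>x\<close> in \<open>S\<close> this is coclosedness of
  \<open>insert x C\<close>, as no part of a break equals \<open>x\<close>. Otherwise the given
  break either is the composition defining \<open>x\<close> or cuts one of its two factors; the
  middle piece \<open>m\<close> joins the other factor, which keeps it in the closure or, by
  \<open>closure_absorb\<close>, in \<open>C\<close>.\<close>

lemma closure_break:
  assumes "x \<in> seg_closure T S" "glue T u v x"
  shows "u \<in> seg_closure T S \<and> v \<in> seg_closure T S \<or> u \<in> C \<or> v \<in> C"
  using assms(1) S_Seg assms(2)
proof (induction x arbitrary: u v rule: seg_closure_induct)
  case (base x)
  then have "u \<in> insert x C \<or> v \<in> insert x C" using Bic_coclosed[OF insert_C] by blast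
  then show ?case using glue_subset[OF base.prems] by blast
next
  case (glue s t w)
  obtain u' v' where uv: "u' = u \<and> v' = v \<or> u' = v \<and> v' = u" and
    c: "u' = s \<and> v' = t \<or> (\<exists>m. glue T u' m s \<and> glue T m t v') \<or> (\<exists>m. glue T s m u' \<and> glue T m v' t)"
    using glue_refine[OF glue.hyps(1) glue.prems] by blast
  let ?K = "seg_closure T S"
  have "u' \<in> ?K \<and> v' \<in> ?K \<or> u' \<in> C \<or> v' \<in> C"
  proof -
    {
      fix m assume m: "glue T u' m s" "glue T m t v'"
      have ?thesis
        using glue.IH(1)[OF m(1)] seg_closure_glue[OF m(2)] glue.hyps(3)
          closure_absorb[OF glue.hyps(3) _ glue_commute[OF m(2)]] by blast
    }
    moreover {
      fix m assume m: "glue T s m u'" "glue T m v' t"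
      have ?thesis
        using glue.IH(2)[OF m(2)] seg_closure_glue[OF m(1)] glue.hyps(2)
          closure_absorb[OF glue.hyps(2) _ m(1)] by blast
    }
    ultimately show ?thesis using c glue.hyps(2,3) by blast
  qed
  with uv show ?case by blast
qed

lemma interval_Bic:
  assumes Y: "Y \<subseteq> seg_closure T S"
    and closed: "\<And>u v w. glue T u v w \<Longrightarrow> u \<in> Y \<Longrightarrow> v \<in> Y \<Longrightarrow> w \<in> Y"
    and coclosed: "\<And>u v w. glue T u v w \<Longrightarrow> w \<in> Y \<Longrightarrow> u \<in> seg_closure T S \<Longrightarrow>
      v \<in> seg_closure T S \<Longrightarrow> u \<in> Y \<or> v \<in> Y"
  shows "(Seg T - C - seg_closure T S) \<union> Y \<in> Bic T"
proof -
  let ?K = "seg_closure T S"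
  let ?M = "Seg T - C - ?K"
  have KSeg: "?K \<subseteq> Seg T" by (rule seg_closure_Seg[OF S_Seg])
  \<comment> \<open>If \<open>w\<close> were in \<open>C\<close>, a part would be in
    \<open>C\<close>; if \<open>w\<close> were in the closure, both parts would be in the closure or
    one in \<open>C\<close>. Neither is possible with \<open>u\<close> in \<open>?M\<close> and
    \<open>v\<close> outside \<open>C\<close>.\<close>
  have M: "w \<in> ?M" if "glue T u v w" "u \<in> ?M" "v \<in> ?M \<union> Y" for u v w
    using closure_break[of w u v] Bic_coclosed[OF C that(1)] glue_Seg[OF that(1)] that Y
      closure_disjoint by blast
  show ?thesis
    unfolding Bic_iff
  proof (intro conjI allI impI)
    show "?M \<union> Y \<subseteq> Seg T" using Y KSeg by blast
  next
    fix u v w assume g: "glue T u v w" and uv: "u \<in> ?M \<union> Y" "v \<in> ?M \<union> Y"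
    then show "w \<in> ?M \<union> Y" using M[OF g] M[OF glue_commute[OF g]] closed[OF g] by blast
  next
    fix u v w assume g: "glue T u v w" and w: "w \<in> ?M \<union> Y"
    have wC: "w \<notin> C" using w Y closure_disjoint by blast
    show "u \<in> ?M \<union> Y \<or> v \<in> ?M \<union> Y"
    proof (rule ccontr)
      assume n: "\<not> ?thesis"
      then have u: "u \<in> C \<or> u \<in> ?K - Y" and v: "v \<in> C \<or> v \<in> ?K - Y"
        using glue_Seg[OF g] by blast+
      \<comment> \<open>Two parts in \<open>C\<close>, or one in \<open>C\<close> and one in the
        closure, would put \<open>w\<close> into \<open>C\<close>.\<close>
      have "u \<in> ?K - Y \<and> v \<in> ?K - Y"
        using u v Bic_closed[OF C g] closure_absorb[of u v w] closure_absorb[of v u w] g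
          glue_commute[OF g] wC by blast
      then show False
        using seg_closure_glue[OF g] coclosed[OF g] w by blast
    qed
  qed
qed

lemma closure_minimal:
  assumes "N \<in> Bic T" "C \<inter> N = {}" "S \<inter> N = {}"
  shows "seg_closure T S \<inter> N = {}"
proof -
  have "seg_closure T S \<subseteq> Seg T - N"
    using Bic_compl[OF assms(1)] assms(3) S_Seg by (intro seg_closure_subset) (auto simp: Bic_def)
  then show ?thesis by blast
qed

text \<open>The case \<open>Y = {}\<close> of \<open>interval_Bic\<close> gives a biclosed lower
  bound. Any other biclosed lower bound avoids \<open>C\<close> and \<open>S\<close>, and since its
  complement is closed it avoids the closure too. With \<open>S\<close> empty, lower bounds would
  not have to avoid \<open>C\<close>.\<close>

lemma bic_Meet_compl:
  assumes "S \<noteq> {}"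
  shows "bic_Meet T ((\<lambda>s. Seg T - insert s C) ` S) = Seg T - C - seg_closure T S"
  unfolding bic_Meet_def
proof (rule Greatest_equality, intro conjI)
  show "Seg T - C - seg_closure T S \<in> Bic T"
    using interval_Bic[of "{}"] by simp
  show "\<forall>B\<in>(\<lambda>s. Seg T - insert s C) ` S. Seg T - C - seg_closure T S \<subseteq> B"
    using subset_seg_closure[of S] by auto
next
  fix N assume N: "N \<in> Bic T \<and> (\<forall>B\<in>(\<lambda>s. Seg T - insert s C) ` S. N \<subseteq> B)"
  then have "N \<subseteq> Seg T - insert s C" if "s \<in> S" for s using that by auto
  then have "C \<inter> N = {}" "S \<inter> N = {}" using assms by auto
  then show "N \<subseteq> Seg T - C - seg_closure T S"
    using closure_minimal[of N] N Bic_Seg[of N] by blast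
qed

section \<open>Covers in the interval and their refined labels\<close>

text \<open>A split of a composition that is not a faultline split cuts one of the factors in two; the
  part of the factor lying on the side of the split avoids \<open>C\<close>, for otherwise it would
  absorb the other factors on its side.\<close>

lemma nonfaultline_split:
  assumes ps: "path_chain T ps" "segment_path T (join_paths ps)" "set ` set ps \<subseteq> S"
    and u: "glue T u v (set (join_paths ps))" "u \<notin> C" and nf: "\<not> faultline T (map set ps) u"
  obtains j r where "j \<in> {1..length ps}" "r \<notin> C" "is_split T r (set (ps ! (j - 1)))"
    "composes T (take (j - 1) (map set ps) @ [r]) u \<or> composes T (r # drop j (map set ps)) u"
proof -
  have ne: "ps \<noteq> []" using ps(1) by (simp add: path_chain_def)
  have K: "set (join_paths qs) \<in> seg_closure T S"
    if "path_chain T qs" "segment_path T (join_paths qs)" "set qs \<subseteq> set ps" for qs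
  proof (rule path_chain_set[OF _ that(1,2)])
    show "seg_closed T (seg_closure T S)"
      unfolding seg_closed_iff using seg_closure_Seg[OF S_Seg] seg_closure_glue by blast
    show "set ` set qs \<subseteq> seg_closure T S" using that(3) ps(3) subset_seg_closure by blast
  qed
  obtain xs b ys where p: "xs \<noteq> []" "ys \<noteq> []" "join_paths ps = xs @ b # ys"
    "u = set (xs @ [b]) \<and> v = set (b # ys) \<or> v = set (xs @ [b]) \<and> u = set (b # ys)"
    by (rule glue_on_path[OF u(1) ps(2) refl])
  have sp: "segment_path T (xs @ [b])" "segment_path T (b # ys)"
    using ps(2) p segment_path_prefix segment_path_suffix by metis+
  have seg: "segment_path T q" if "q \<in> set ps" for q
    using ps(1) that by (simp add: path_chain_def)
  from join_paths_split[OF ps(1) p(3,1,2)] show thesis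
  proof (elim disjE exE conjE)
    fix j assume j: "1 \<le> j" "j < length ps" "join_paths (take j ps) = xs @ [b]" "join_paths (drop j ps) = b # ys"
    have "path_chain T (take j ps @ drop j ps)" using ps(1) by simp
    then have "path_chain T (take j ps)" "path_chain T (drop j ps)"
      using j(1,2) ne path_chain_append[of "take j ps" "drop j ps"] by auto
    then have "composes T (take j (map set ps)) (set (xs @ [b]))" "composes T (drop j (map set ps)) (set (b # ys))"
      unfolding composes_iff using sp j(3,4) by (metis take_map, metis drop_map)
    \<comment> \<open>\<open>faultline\<close> drops one factor fewer than its index, hence
      \<open>Suc j\<close> for the final part.\<close>
    moreover have "j \<in> {1..length (map set ps) - 1}" "Suc j \<in> {2..length (map set ps)}" using j(1,2) by auto
    ultimately have "faultline T (map set ps) (set (xs @ [b]))" "faultline T (map set ps) (set (b # ys))"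
      unfolding faultline_def by (metis, metis diff_Suc_1)
    then show thesis using nf p(4) by blast
  next
    fix j xs' ys' assume j: "j < length ps" "xs' \<noteq> []" "ys' \<noteq> []" "ps ! j = xs' @ b # ys'"
      "join_paths (take j ps @ [xs' @ [b]]) = xs @ [b]" "join_paths ((b # ys') # drop (Suc j) ps) = b # ys"
    have pj: "segment_path T (xs' @ b # ys')" using seg j(1,4) by (metis nth_mem)
    have sp': "segment_path T (xs' @ [b])" "segment_path T (b # ys')"
      using segment_path_prefix[OF pj j(2)] segment_path_suffix[OF pj j(3)] .
    have g: "glue T (set (xs' @ [b])) (set (b # ys')) (set (ps ! j))"
      using glueI[OF pj j(2,3)] j(4) by simp
    have c: "path_chain T (take j ps @ (xs' @ b # ys') # drop (Suc j) ps)"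
      using ps(1) id_take_nth_drop[OF j(1)] j(4) by metis
    have pre: "path_chain T (take j ps)" "last (last (take j ps)) = hd (xs' @ [b])" if "take j ps \<noteq> []"
      using c path_chain_append[OF that, of "(xs' @ b # ys') # drop (Suc j) ps"] j(2) by auto
    have c': "path_chain T ((xs' @ b # ys') # drop (Suc j) ps)"
      using c path_chain_append[of "take j ps" "(xs' @ b # ys') # drop (Suc j) ps"] by (cases "take j ps = []") auto
    have suf: "path_chain T (drop (Suc j) ps)" "last (b # ys') = hd (hd (drop (Suc j) ps))"
      if "drop (Suc j) ps \<noteq> []"
      using c' path_chain_Cons[OF that, of T "xs' @ b # ys'"] by auto
    have L: "path_chain T (take j ps @ [xs' @ [b]])"
    proof (cases "take j ps = []")
      case True
      then show ?thesis using sp' by (simp only: append_Nil path_chain_single)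
    next
      case False
      then show ?thesis
        using pre sp' path_chain_append[OF False, of "[xs' @ [b]]" T] by (simp add: path_chain_single)
    qed
    have R: "path_chain T ((b # ys') # drop (Suc j) ps)"
    proof (cases "drop (Suc j) ps = []")
      case True
      then show ?thesis using sp' by (simp only: append_Nil path_chain_single)
    next
      case False
      then show ?thesis
        using suf sp' path_chain_Cons[OF False, of T "b # ys'"] by simp
    qed
    have jI: "Suc j \<in> {1..length ps}" using j(1) by simp
    from p(4) show thesis
    proof
      assume uv: "u = set (xs @ [b]) \<and> v = set (b # ys)"
      have "set (xs' @ [b]) \<notin> C"
      proof
        assume xC: "set (xs' @ [b]) \<in> C"
        show False
        proof (cases "take j ps = []")
          case True
          then have "xs' @ [b] = xs @ [b]" using j(5) by (simp only: append_Nil) simp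
          then show False using xC uv u(2) by metis
        next
          case False
          \<comment> \<open>\<open>e\<close> is where the preceding factors meet the cut one.
            Cutting \<open>u\<close> there exhibits it as an element of the closure composed with
            the supposed element of \<open>C\<close>.\<close>
          obtain us e where t: "join_paths (take j ps) = us @ [e]" "us \<noteq> []"
            using path_chain_last[OF pre(1)[OF False]]
            by (cases "join_paths (take j ps)" rule: rev_cases) (auto simp: Suc_le_eq)
          obtain zs where z: "xs' @ [b] = e # zs" "zs \<noteq> []"
            using path_chain_last[OF pre(1)[OF False]] pre(2)[OF False] t(1) j(2)
            by (cases xs') auto
          have e: "xs @ [b] = us @ e # zs"
            using join_paths_append[OF False, of "[xs' @ [b]]"] z(1) unfolding j(5) t(1) by simp
          have ue: "segment_path T (us @ e # zs)" using sp(1) e by simp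
          note g' = glueI[OF ue t(2) z(2) refl refl refl]
          have "set (us @ [e]) \<in> seg_closure T S"
            using K[OF pre(1)[OF False]] segment_path_prefix[OF ue t(2)] set_take_subset[of j ps]
            unfolding t(1) by blast
          then show False using closure_absorb[OF _ _ g'] xC e uv u(2) unfolding z(1) by metis
        qed
      qed
      moreover have "composes T (take j (map set ps) @ [set (xs' @ [b])]) u"
        unfolding composes_iff using L j(5) sp(1) uv
        by (intro exI[of _ "take j ps @ [xs' @ [b]]"]) (simp add: take_map)
      moreover have "is_split T (set (xs' @ [b])) (set (ps ! j))" using g is_split_iff by blast
      ultimately show thesis using that[OF jI] by (metis diff_Suc_1)
    next
      assume uv: "v = set (xs @ [b]) \<and> u = set (b # ys)"
      have "set (b # ys') \<notin> C"
      proof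
        assume yC: "set (b # ys') \<in> C"
        show False
        proof (cases "drop (Suc j) ps = []")
          case True
          then have "b # ys' = b # ys" using j(6) by (simp only:) simp
          then show False using yC uv u(2) by metis
        next
          case False
          obtain us e where t: "b # ys' = us @ [e]" "us \<noteq> []"
            using j(3) by (cases ys' rule: rev_cases) auto
          obtain zs where z: "join_paths (drop (Suc j) ps) = e # zs" "zs \<noteq> []"
            using path_chain_join_Cons[OF suf(1)[OF False]] suf(2)[OF False] t(1) by (metis last_snoc)
          have e: "b # ys = us @ e # zs"
            using join_paths_Cons[OF False path_chain_hd(1)[OF suf(1)[OF False]], of "b # ys'"] j(6) t(1) z
            by (metis append_Cons append_assoc append_Nil list.sel(3))
          have ue: "segment_path T (us @ e # zs)" using sp(2) e by simp
          note g' = glueI[OF ue t(2) z(2) refl refl refl]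
          have "set (e # zs) \<in> seg_closure T S"
            using K[OF suf(1)[OF False]] segment_path_suffix[OF ue z(2)] set_drop_subset[of "Suc j" ps]
            unfolding z(1) by blast
          then show False
            using closure_absorb[OF _ _ glue_commute[OF g']] yC e uv u(2) unfolding t(1) by metis
        qed
      qed
      moreover have "composes T (set (b # ys') # drop (Suc j) (map set ps)) u"
        unfolding composes_iff using R j(6) sp(2) uv
        by (intro exI[of _ "(b # ys') # drop (Suc j) ps"]) (simp add: drop_map del: join_paths.simps)
      moreover have "is_split T (set (b # ys')) (set (ps ! j))"
        using g glue_commute is_split_iff by blast
      ultimately show thesis using that[OF jI] by (metis diff_Suc_1)
    qed
  qed
qed

text \<open>Let \<open>0, \<dots>, n\<close> be the vertices of \<open>x\<close> in order.  Besides \<open>Seg T - C - K\<close>, the upper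
  set of the cover consists of those \<open>[a, b] \<in> K\<close> with \<open>a = 0\<close> or \<open>[a, n] \<in> E\<close>, and
  \<open>b = n\<close> or \<open>[0, b] \<in> E\<close>.  No two of these compose, since no vertex is both a
  right end and a left end.\<close>

lemma cover_with_label_exists:
  assumes x: "x \<in> seg_closure T S"
    and E: "\<And>u. u \<in> E \<Longrightarrow> is_split T u x" "E \<inter> C = {}"
    and one: "\<And>u v. glue T u v x \<Longrightarrow> u \<in> E \<longleftrightarrow> v \<notin> E"
  obtains W where "Seg T - C - seg_closure T S \<subseteq> W" "W \<in> Bic T" "insert x W \<in> Bic T"
    "x \<notin> W" "W \<inter> C = {}" "{u \<in> W. is_split T u x} = E"
proof -
  let ?K = "seg_closure T S"
  let ?M = "Seg T - C - ?K"
  have "x \<in> Seg T" using x seg_closure_Seg[OF S_Seg] by blast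
  then obtain p where p: "segment_path T p" "x = set p" unfolding Seg_def by blast
  have d: "distinct p" using p(1) segment_path_distinct by blast
  define J where "J = {k \<in> ?K. \<exists>xs q ys. p = xs @ q @ ys \<and> k = set q \<and> q \<noteq> [] \<and>
    (xs = [] \<or> set (q @ ys) \<in> E) \<and> (ys = [] \<or> set (xs @ q) \<in> E)}"
  \<comment> \<open>By \<open>infix_unique\<close> the witnesses hidden in \<open>J\<close> must be
    the given \<open>xs\<close> and \<open>ys\<close>.\<close>
  have JD: "(xs = [] \<or> set (q @ ys) \<in> E) \<and> (ys = [] \<or> set (xs @ q) \<in> E)"
    if J: "set q \<in> J" and pq: "p = xs @ q @ ys" for xs q ys
  proof -
    obtain us r vs where r: "p = us @ r @ vs" "set q = set r" "r \<noteq> []"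
      "us = [] \<or> set (r @ vs) \<in> E" "vs = [] \<or> set (us @ r) \<in> E"
      using J unfolding J_def by blast
    have "q \<noteq> []" using r(2,3) by auto
    moreover have "distinct (xs @ q @ ys)" "xs @ q @ ys = us @ r @ vs" using d pq r(1) by metis+
    ultimately have "xs = us" "q = r" "ys = vs" using infix_unique r(2) by metis+
    then show ?thesis using r(4,5) by simp
  qed
  have JI: "set q \<in> J" if "set q \<in> ?K" "p = xs @ q @ ys" "q \<noteq> []"
    "xs = [] \<or> set (q @ ys) \<in> E" "ys = [] \<or> set (xs @ q) \<in> E" for xs q ys
    using that unfolding J_def by blast
  have cut: "set (xs @ [b]) \<in> E \<longleftrightarrow> set (b # ys) \<notin> E"
    if "p = xs @ b # ys" "xs \<noteq> []" "ys \<noteq> []" for xs b ys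
    using one glueI[of T xs b ys] that p by simp
  have JK: "J \<subseteq> ?K" by (auto simp: J_def)
  have Jx: "k \<subseteq> x" if "k \<in> J" for k using that p(2) by (auto simp: J_def)
  have xJ: "x \<in> J"
    using JI[of p "[]" "[]"] x p segment_path_length[OF p(1)] by fastforce
  have no_glue: "\<not> glue T u v w" if "u \<in> J" "v \<in> J" for u v w
  proof
    assume g: "glue T u v w"
    obtain r where r: "segment_path T r" "w = set r" using glue_Seg(3)[OF g] unfolding Seg_def by blast
    have "w = u \<union> v" using g unfolding glue_def by auto
    then have "set r \<subseteq> set p" using Jx[OF that(1)] Jx[OF that(2)] r p by blast
    from tree_subpath[OF tree p(1) r(1) this] obtain xs q ys
      where q: "segment_path T q" "set q = w" "p = xs @ q @ ys"
      using r segment_path_rev[OF r(1)] by (metis set_rev)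
    obtain as b bs where b: "as \<noteq> []" "bs \<noteq> []" "q = as @ b # bs"
      "u = set (as @ [b]) \<and> v = set (b # bs) \<or> v = set (as @ [b]) \<and> u = set (b # bs)"
      by (rule glue_on_path[OF g q(1,2)])
    have "set (as @ [b]) \<in> J" "set (b # bs) \<in> J" using b(4) that by blast+
    then have "set (xs @ as @ [b]) \<in> E" "set (b # bs @ ys) \<in> E"
      using JD[of "as @ [b]" xs "bs @ ys"] JD[of "b # bs" "xs @ as" ys] q(3) b(1-3) by auto
    then show False using cut[of "xs @ as" b "bs @ ys"] q(3) b(1-3) by simp
  qed
  have split_J: "u \<in> J \<or> v \<in> J" if g: "glue T u v w" and "w \<in> J" "u \<in> ?K" "v \<in> ?K" for u v w
  proof -
    obtain xs k ys where k: "p = xs @ k @ ys" "w = set k" "k \<noteq> []"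
      "xs = [] \<or> set (k @ ys) \<in> E" "ys = [] \<or> set (xs @ k) \<in> E"
      using \<open>w \<in> J\<close> unfolding J_def by blast
    have "2 \<le> length k"
    proof -
      obtain r where r: "segment_path T r" "w = set r" using glue_Seg(3)[OF g] unfolding Seg_def by blast
      then have "2 \<le> card w" using segment_path_length segment_path_distinct distinct_card by metis
      then show ?thesis using k(2) card_length[of k] by simp
    qed
    then have sk: "segment_path T k" using segment_path_sub p(1) k(1) by metis
    obtain as b bs where b: "as \<noteq> []" "bs \<noteq> []" "k = as @ b # bs"
      "u = set (as @ [b]) \<and> v = set (b # bs) \<or> v = set (as @ [b]) \<and> u = set (b # bs)"
      by (rule glue_on_path[OF g sk k(2)[symmetric]])
    have K: "set (as @ [b]) \<in> ?K" "set (b # bs) \<in> ?K" using b(4) that(3,4) by blast+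
    \<comment> \<open>The side chosen by \<open>E\<close> at \<open>b\<close> decides which part
      stays in \<open>J\<close>: its condition at \<open>b\<close> comes from \<open>E\<close>, the
      one at its other end from \<open>w\<close>.\<close>
    have "set (xs @ as @ [b]) \<in> E \<or> set (b # bs @ ys) \<in> E"
      using cut[of "xs @ as" b "bs @ ys"] k(1) b(1-3) by auto
    then have "set (as @ [b]) \<in> J \<or> set (b # bs) \<in> J"
    proof
      assume "set (xs @ as @ [b]) \<in> E"
      then show ?thesis using JI[of "as @ [b]" xs "bs @ ys"] K k b(3) by simp
    next
      assume "set (b # bs @ ys) \<in> E"
      then show ?thesis using JI[of "b # bs" "xs @ as" ys] K k b(3) by simp
    qed
    then show ?thesis using b(4) by blast
  qed
  \<comment> \<open>All elements of \<open>J\<close> are subsets of \<open>x\<close>, so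
    \<open>x\<close> is never a proper part of one of them. Hence \<open>J\<close> and
    \<open>J - {x}\<close> both satisfy the conditions of \<open>interval_Bic\<close>.\<close>
  define W where "W = ?M \<union> (J - {x})"
  have W: "W \<in> Bic T"
    unfolding W_def
  proof (rule interval_Bic)
    fix u v w assume h: "glue T u v w" "w \<in> J - {x}" "u \<in> ?K" "v \<in> ?K"
    have "u \<noteq> x" "v \<noteq> x" using Jx[of w] glue_subset(1,2)[OF h(1)] h(2) by blast+
    then show "u \<in> J - {x} \<or> v \<in> J - {x}" using split_J[OF h(1) _ h(3,4)] h(2) by blast
  qed (use JK no_glue in blast)+
  have "?M \<union> J \<in> Bic T"
    by (rule interval_Bic) (use JK no_glue split_J in blast)+
  moreover have ins: "insert x W = ?M \<union> J" using xJ unfolding W_def by blast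
  ultimately have Z: "insert x W \<in> Bic T" by simp
  have xW: "x \<notin> W" using x unfolding W_def by blast
  have side: "u \<in> E" if "u \<in> J" and g: "glue T u v x" for u v
  proof -
    obtain xs b ys where b: "xs \<noteq> []" "ys \<noteq> []" "p = xs @ b # ys"
      "u = set (xs @ [b]) \<and> v = set (b # ys) \<or> v = set (xs @ [b]) \<and> u = set (b # ys)"
      by (rule glue_on_path[OF g p(1) p(2)[symmetric]])
    show ?thesis
      using b(4) JD[of "xs @ [b]" "[]" ys] JD[of "b # ys" xs "[]"] b(1-3) that(1) by auto
  qed
  have "u \<in> W \<longleftrightarrow> u \<in> E" if g: "glue T u v x" for u v
  proof
    assume u: "u \<in> W"
    show "u \<in> E"
    proof (rule ccontr)
      assume "u \<notin> E"
      \<comment> \<open>A break of \<open>x\<close> with one part in \<open>?M\<close> has the other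
        in \<open>C\<close>. As \<open>v\<close> is in \<open>E\<close>, this is excluded, so
        \<open>u\<close> comes from \<open>J\<close>, where \<open>side\<close> applies.\<close>
      then have "v \<notin> C" using one[OF g] E(2) by blast
      then have "u \<notin> ?M" using closure_break[OF x g] by blast
      then show False using u side[OF _ g] \<open>u \<notin> E\<close> unfolding W_def by blast
    qed
  next
    assume u: "u \<in> E"
    show "u \<in> W"
    proof (cases "u \<in> ?K")
      case True
      obtain xs b ys where b: "xs \<noteq> []" "ys \<noteq> []" "p = xs @ b # ys"
        "u = set (xs @ [b]) \<and> v = set (b # ys) \<or> v = set (xs @ [b]) \<and> u = set (b # ys)"
        by (rule glue_on_path[OF g p(1) p(2)[symmetric]])
      have "u \<in> J"
        using b(4) JI[of "xs @ [b]" "[]" ys] JI[of "b # ys" xs "[]"] b(1-3) True u by auto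
      then show ?thesis using glue_subset(1)[OF g] unfolding W_def by blast
    next
      case False
      then show ?thesis using u E(2) glue_Seg(1)[OF g] unfolding W_def by blast
    qed
  qed
  then have "{u \<in> W. is_split T u x} = E" using E(1) is_split_iff by blast
  moreover have "W \<inter> C = {}" using JK closure_disjoint unfolding W_def by blast
  ultimately show thesis using that[OF _ W Z xW] unfolding W_def by blast
qed

end

end

section \<open>The labels of the interval compared with the combinatorial description\<close>

theorem theorem5p1:
  fixes T :: "'v plane_tree"
    and B :: "'v set set"
    and k :: nat
    and Bs :: "nat \<Rightarrow> 'v set set"
    and s :: "nat \<Rightarrow> 'v set"
    and D :: "nat \<Rightarrow> 'v set set"
  assumes "is_plane_tree T"
    and "B \<in> Bic T"
    and "bij_betw Bs {1..k} {B'. bic_covers T B' B}"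
    and "\<And>i. i \<in> {1..k} \<Longrightarrow> refined_label T (Bs i) B = (s i, D i)"
  shows "shard_psi T B =
    {(t, E) | t E js.
        js \<noteq> [] \<and> set js \<subseteq> {1..k} \<and>
        composes T (map s js) t \<and> t \<in> seg_closure T (s ` {1..k}) \<and>
        card E = card (breaks T t) \<and>
        (\<forall>u\<in>E. is_split T u t) \<and>
        (\<forall>u1\<in>E. \<forall>u2\<in>E. u1 \<noteq> u2 \<longrightarrow> \<not> (\<exists>b\<in>breaks T t. u1 \<in> b \<and> u2 \<in> b)) \<and>
        (\<forall>u\<in>E. \<not> faultline T (map s js) u \<longrightarrow>
           (\<exists>j\<in>{1..length js}. \<exists>tj\<in>D (js ! (j - 1)).
              composes T (take (j - 1) (map s js) @ [tj]) u) \<or>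
           (\<exists>j\<in>{1..length js}. \<exists>tj\<in>D (js ! (j - 1)).
              composes T (tj # drop j (map s js)) u))}"
proof -
  have T: "is_tree T" using assms(1) by (simp add: is_plane_tree_def)
  interpret segment_tree T by unfold_locales (rule T)
  let ?C = "Seg T - B" and ?S = "s ` {1..k}"
  let ?K = "seg_closure T ?S"
  have BSeg: "B \<subseteq> Seg T" using Bic_Seg[OF assms(2)] .
  have covers: "{B'. bic_covers T B' B} = Bs ` {1..k}" using assms(3) by (simp add: bij_betw_def)
  have s: "s i \<in> B" "Bs i = B - {s i}" "Bs i \<in> Bic T" "D i = {u \<in> B - {s i}. is_split T u (s i)}"
    if i: "i \<in> {1..k}" for i
  proof -
    have c: "bic_covers T (Bs i) B" using covers i by blast
    then obtain x where x: "x \<notin> Bs i" "B = insert x (Bs i)" by (rule bic_covers_insert)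
    then have "B - Bs i = {x}" by blast
    then have "s i = x" using assms(4)[OF i] by (simp add: refined_label_def label_def)
    then show "s i \<in> B" "Bs i = B - {s i}" using x by auto
    then show "Bs i \<in> Bic T" "D i = {u \<in> B - {s i}. is_split T u (s i)}"
      using c assms(4)[OF i] \<open>s i = x\<close> \<open>B - Bs i = {x}\<close>
      by (auto simp: bic_covers_def refined_label_def label_def)
  qed
  have C: "?C \<in> Bic T" using Bic_compl[OF assms(2)] .
  have SC: "?S \<inter> ?C = {}" using s(1) by blast
  have insert_C: "insert x ?C \<in> Bic T" if xS: "x \<in> ?S" for x
  proof -
    obtain i where i: "i \<in> {1..k}" "x = s i" using xS by blast
    have "insert x ?C = Seg T - Bs i" using s(1,2)[OF i(1)] i(2) BSeg by blast
    then show ?thesis using Bic_compl[OF s(3)[OF i(1)]] by simp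
  qed
  have SSeg: "?S \<subseteq> Seg T" using s(1) BSeg by blast
  have KB: "?K \<subseteq> B"
    using closure_disjoint[OF C SC insert_C] seg_closure_Seg[OF SSeg] by blast
  have Meet: "bic_Meet T {B'. bic_covers T B' B} = B - ?K" if "k \<noteq> 0"
  proof -
    have "Bs ` {1..k} = (\<lambda>x. Seg T - insert x ?C) ` ?S"
      unfolding image_image using s(2) BSeg by (intro image_cong) auto
    moreover have "Seg T - ?C = B" using BSeg by blast
    ultimately show ?thesis
      using bic_Meet_compl[OF C SC insert_C] that covers by simp
  qed
  \<comment> \<open>The greatest lower bound of the empty family is \<open>Seg T\<close>, which
    leaves no segment to be a label; for \<open>k = 0\<close> the right-hand side is empty too,
    because \<open>js\<close> is nonempty.\<close>
  have Meet0: "bic_Meet T {B'. bic_covers T B' B} = Seg T" if "k = 0"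
  proof -
    have "Seg T \<in> Bic T" using glue_Seg unfolding Bic_iff by blast
    then show ?thesis
      unfolding bic_Meet_def using covers that Bic_Seg by (intro Greatest_equality) auto
  qed
  show ?thesis (is "_ = ?R")
  proof (intro equalityI subsetI)
    fix l assume "l \<in> shard_psi T B"
    then obtain W Z where l: "l = refined_label T W Z"
      and WZ: "bic_Meet T {B'. bic_covers T B' B} \<subseteq> W" "bic_covers T W Z" "Z \<subseteq> B"
      unfolding shard_psi_def by blast
    obtain x where x: "x \<notin> W" "Z = insert x W" using bic_covers_insert[OF WZ(2)] .
    have W: "W \<in> Bic T" and Z: "Z \<in> Bic T" using WZ(2) by (auto simp: bic_covers_def)
    have "Z - W = {x}" using x by blast
    define E where "E = {u \<in> W. is_split T u x}"
    have lE: "l = (x, E)" using l \<open>Z - W = {x}\<close> by (simp add: refined_label_def label_def E_def)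
    have xB: "x \<in> B" using x WZ(3) by blast
    have "k \<noteq> 0" using Meet0 WZ(1) x(1) xB BSeg by blast
    then have xK: "x \<in> ?K" using Meet WZ(1) x(1) xB by blast
    obtain p where p: "segment_path T p" "set p = x" using xB BSeg unfolding Seg_def by blast
    obtain ps where ps: "path_chain T ps" "join_paths ps = p" "set ` set ps \<subseteq> ?S"
      using closure_path_chain[OF xK SSeg p] .
    define js where "js = map (inv_into {1..k} s \<circ> set) ps"
    have js: "js \<noteq> []" "set js \<subseteq> {1..k}" "map s js = map set ps"
      using ps(1,3) inv_into_into[of _ s "{1..k}"] f_inv_into_f[of _ s "{1..k}"]
      by (auto simp: js_def path_chain_def)
    have comp: "composes T (map s js) x"
      unfolding js(3) composes_iff using ps(1,2) p by blast
    \<comment> \<open>\<open>x\<close> is not a part of its own break, so coclosedness of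
      \<open>Z\<close> gives a part in \<open>W\<close>, while closedness of \<open>W\<close>, which
      lacks \<open>x\<close>, forbids both.\<close>
    have one: "u \<in> E \<longleftrightarrow> v \<notin> E" if g: "glue T u v x" for u v
    proof -
      have "u \<in> W \<or> v \<in> W" using Bic_coclosed[OF Z g] x(2) glue_subset(1,2)[OF g] by blast
      moreover have "\<not> (u \<in> W \<and> v \<in> W)" using Bic_closed[OF W g] x(1) by blast
      ultimately show ?thesis
        unfolding E_def using g glue_commute[OF g] is_split_iff by blast
    qed
    have split: "is_split T u x" if "u \<in> E" for u using that by (simp add: E_def)
    have card: "card E = card (breaks T x) \<and>
        (\<forall>u1\<in>E. \<forall>u2\<in>E. u1 \<noteq> u2 \<longrightarrow> \<not> (\<exists>b\<in>breaks T x. u1 \<in> b \<and> u2 \<in> b))"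
      using one_split_per_break[of E x] split one by blast
    have nf: "(\<exists>j\<in>{1..length js}. \<exists>tj\<in>D (js ! (j - 1)). composes T (take (j - 1) (map s js) @ [tj]) u) \<or>
        (\<exists>j\<in>{1..length js}. \<exists>tj\<in>D (js ! (j - 1)). composes T (tj # drop j (map s js)) u)"
      if u: "u \<in> E" "\<not> faultline T (map s js) u" for u
    proof -
      obtain v where v: "glue T u v x" using split[OF u(1)] is_split_iff by blast
      have "u \<notin> ?C" using u(1) x(2) WZ(3) by (auto simp: E_def)
      then obtain j r where j: "j \<in> {1..length ps}" "r \<notin> ?C" "is_split T r (set (ps ! (j - 1)))"
        "composes T (take (j - 1) (map set ps) @ [r]) u \<or> composes T (r # drop j (map set ps)) u"
        using nonfaultline_split[OF C SC insert_C ps(1) _ ps(3), of u v] p ps(2) v u(2) js(3) by metis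
      have len: "length js = length ps" using js(3) by (metis length_map)
      then have "js ! (j - 1) \<in> {1..k}" using j(1) by (intro subsetD[OF js(2)] nth_mem) auto
      moreover have "s (js ! (j - 1)) = set (ps ! (j - 1))"
      proof -
        have "j - 1 < length js" using j(1) len by auto
        then show ?thesis using len js(3) by (metis nth_map)
      qed
      moreover have "r \<in> Seg T" "r \<noteq> set (ps ! (j - 1))" using j(3) by (auto simp: is_split_def)
      ultimately have "r \<in> D (js ! (j - 1))" using s(4) j(2,3) by auto
      then show ?thesis using j(1,4) len js(3) by metis
    qed
    show "l \<in> ?R"
      unfolding lE
      by (rule CollectI, rule exI[of _ x], rule exI[of _ E], rule exI[of _ js], intro conjI,
          rule refl, rule js(1), rule js(2), rule comp, rule xK, rule conjunct1[OF card],
          rule ballI, rule split, assumption, rule conjunct2[OF card],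
          rule ballI, rule impI, rule nf, assumption+)
  next
    fix l assume "l \<in> ?R"
    then obtain x E js where l: "l = (x, E)" and js: "js \<noteq> []" "set js \<subseteq> {1..k}"
      and comp: "composes T (map s js) x" and xK: "x \<in> ?K"
      and card: "card E = card (breaks T x)"
        "(\<forall>u1\<in>E. \<forall>u2\<in>E. u1 \<noteq> u2 \<longrightarrow> \<not> (\<exists>b\<in>breaks T x. u1 \<in> b \<and> u2 \<in> b))"
      and split: "\<forall>u\<in>E. is_split T u x"
      and nf: "\<forall>u\<in>E. \<not> faultline T (map s js) u \<longrightarrow>
        (\<exists>j\<in>{1..length js}. \<exists>tj\<in>D (js ! (j - 1)). composes T (take (j - 1) (map s js) @ [tj]) u) \<or>
        (\<exists>j\<in>{1..length js}. \<exists>tj\<in>D (js ! (j - 1)). composes T (tj # drop j (map s js)) u)"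
      unfolding mem_Collect_eq by (elim exE conjE) (rule that)
    have "\<forall>u v. glue T u v x \<longrightarrow> (u \<in> E \<longleftrightarrow> v \<notin> E)"
      by (rule iffD1[OF one_split_per_break conjI[OF card]]) (rule bspec[OF split])
    then have one: "u \<in> E \<longleftrightarrow> v \<notin> E" if "glue T u v x" for u v
      using that by simp
    have Bcl: "seg_closed T B" using assms(2) by (simp add: Bic_def)
    have sB: "set (map s js) \<subseteq> B" using js(2) s(1) by auto
    have tjB: "tj \<in> B" if "j \<in> {1..length js}" "tj \<in> D (js ! (j - 1))" for j tj
    proof -
      have "js ! (j - 1) \<in> {1..k}" using that(1) by (intro subsetD[OF js(2)] nth_mem) auto
      then show ?thesis using s(4) that(2) by blast
    qed
    \<comment> \<open>Here condition (iv) enters: faultline splits are composed of labels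
      \<open>s i\<close>, the others of such labels and one element of some \<open>D i\<close>, all
      of which lie in the closed set \<open>B\<close>.\<close>
    have EB: "u \<in> B" if u: "u \<in> E" for u
    proof (cases "faultline T (map s js) u")
      case True
      then obtain ss where "composes T ss u" "set ss \<subseteq> set (map s js)"
        unfolding faultline_def by (metis set_take_subset set_drop_subset)
      then show ?thesis using composes_closed[OF _ _ Bcl] sB by blast
    next
      case False
      with nf u obtain j tj ss where "j \<in> {1..length js}" "tj \<in> D (js ! (j - 1))" "composes T ss u"
        "ss = take (j - 1) (map s js) @ [tj] \<or> ss = tj # drop j (map s js)"
        by metis
      moreover from this have "set ss \<subseteq> B"
        using tjB by (auto dest: subsetD[OF subset_trans[OF set_take_subset sB]]
            subsetD[OF subset_trans[OF set_drop_subset sB]])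
      ultimately show ?thesis using composes_closed[OF _ _ Bcl] by blast
    qed
    obtain W where W: "Seg T - ?C - ?K \<subseteq> W" "W \<in> Bic T" "insert x W \<in> Bic T"
      "x \<notin> W" "W \<inter> ?C = {}" "{u \<in> W. is_split T u x} = E"
      using cover_with_label_exists[OF C SC insert_C xK, of E] split EB one by blast
    have "k \<noteq> 0" using js by (cases js) auto
    then have "bic_Meet T {B'. bic_covers T B' B} \<subseteq> W" using Meet W(1) BSeg by blast
    moreover have "bic_covers T W (insert x W)" using bic_covers_insertI[OF W(2,3,4)] .
    moreover have "insert x W \<subseteq> B" using W(5) Bic_Seg[OF W(2)] xK KB by blast
    moreover have "refined_label T W (insert x W) = l"
    proof -
      have "insert x W - W = {x}" using W(4) by blast
      then show ?thesis using W(6) l by (simp add: refined_label_def label_def)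
    qed
    ultimately show "l \<in> shard_psi T B" unfolding shard_psi_def by blast
  qed
qed

end
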